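(* For every integer $n\ge 0$, $$B_3(30n+10)\equiv B_3(30n+28)\equiv 0 \pmod{120}.$$
   Context: A partition is a 3-core if none of its hook numbers is a multiple of 3 (the empty partition is a 3-core). For an integer $n\ge 0$, $B_3(n)$ denotes the number of partition triples of $n$ with 3-cores, i.e. ordered triples $(\lambda_1,\lambda_2,\lambda_3)$ of (possibly empty) partitions, each a 3-core, such that the sum of all the parts of $\lambda_1,\lambda_2,\lambda_3$ equals $n$; in particular $B_3(0)=1$. Equivalently (a standard fact recalled in the paper), $\sum_{n\ge 0}B_3(n)q^n=\dfrac{f_3^9}{f_1^3}$, where $f_k=\prod_{m=1}^{\infty}(1-q^{km})$. *)

theory Defs
  imports "HOL-Number_Theory.Number_Theory"
begin

text \<open>
  A partition is the weakly decreasing list of its (positive) parts; the empty list is the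
  empty partition.  Rows and columns of the Young diagram are counted from 0, so the cells
  are the pairs \<open>(i, j)\<close> with \<open>i < length l\<close> and \<open>j < l ! i\<close>.
\<close>

definition is_partition :: "nat list \<Rightarrow> bool" where
  "is_partition l \<longleftrightarrow> sorted_wrt (\<ge>) l \<and> (\<forall>p\<in>set l. 0 < p)"

definition cells :: "nat list \<Rightarrow> (nat \<times> nat) set" where
  "cells l = {(i, j). i < length l \<and> j < l ! i}"

definition arm :: "nat list \<Rightarrow> nat \<Rightarrow> nat \<Rightarrow> nat" where
  "arm l i j = card {k. j < k \<and> (i, k) \<in> cells l}"

definition leg :: "nat list \<Rightarrow> nat \<Rightarrow> nat \<Rightarrow> nat" where
  "leg l i j = card {k. i < k \<and> (k, j) \<in> cells l}"

definition hook_number :: "nat list \<Rightarrow> nat \<Rightarrow> nat \<Rightarrow> nat" where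
  "hook_number l i j = arm l i j + leg l i j + 1"

definition is_core :: "nat \<Rightarrow> nat list \<Rightarrow> bool" where
  "is_core t l \<longleftrightarrow> is_partition l \<and> (\<forall>(i, j)\<in>cells l. \<not> t dvd hook_number l i j)"

definition core_triples :: "nat \<Rightarrow> nat \<Rightarrow> (nat list \<times> nat list \<times> nat list) set" where
  "core_triples t n =
     {(a, b, c). is_core t a \<and> is_core t b \<and> is_core t c \<and>
                 sum_list a + sum_list b + sum_list c = n}"

definition B3 :: "nat \<Rightarrow> nat" where
  "B3 n = card (core_triples 3 n)"

text \<open>The set counted by \<open>B3\<close> is finite, so \<open>card\<close> does count it.\<close>

lemma length_le_sum_list_if_pos:
  fixes l :: "nat list"
  assumes "\<forall>p\<in>set l. 0 < p"
  shows "length l \<le> sum_list l"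
  using assms by (induction l) auto

lemma finite_core_triples: "finite (core_triples t n)"
proof -
  let ?P = "{l :: nat list. set l \<subseteq> {..n} \<and> length l \<le> n}"
  have bound: "l \<in> ?P" if "is_core t l" "sum_list l \<le> n" for l
  proof -
    have "length l \<le> sum_list l"
      using that(1) by (intro length_le_sum_list_if_pos) (simp add: is_core_def is_partition_def)
    moreover have "x \<le> sum_list l" if "x \<in> set l" for x
      using that by (simp add: member_le_sum_list)
    ultimately show ?thesis
      using that(2) by fastforce
  qed
  have "core_triples t n \<subseteq> ?P \<times> ?P \<times> ?P"
  proof
    fix x assume x: "x \<in> core_triples t n"
    obtain a b c where abc: "x = (a, b, c)" by (cases x)
    have "a \<in> ?P" "b \<in> ?P" "c \<in> ?P"
      using x unfolding abc core_triples_def by (intro bound; simp)+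
    then show "x \<in> ?P \<times> ?P \<times> ?P" unfolding abc by blast
  qed
  moreover have "finite ?P"
    by (rule finite_lists_length_le) simp
  ultimately show ?thesis
    by (meson finite_SigmaI finite_subset)
qed

lemma B3_0: "B3 0 = 1"
proof -
  have "l = []" if "is_core 3 l" "sum_list l = 0" for l
    using that by (cases l) (auto simp: is_core_def is_partition_def)
  moreover have "is_core 3 []"
    by (simp add: is_core_def is_partition_def cells_def)
  ultimately have "core_triples 3 0 = {([], [], [])}"
    unfolding core_triples_def by auto
  then show ?thesis by (simp add: B3_def)
qed

end

theory Submission
  imports Defs "HOL-Complex_Analysis.Cauchy_Integral_Formula"
begin

text \<open>
  Why the congruences hold.  The proof establishes the exact formula

    \<open>B3 n = \<Sum> chi3 j * k\<^sup>2\<close>, summed over all factorisations \<open>j * k = n + 1\<close>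

  (theorem \<open>B3_eq_twisted_divisor_sum\<close>), where \<open>chi3\<close> is the quadratic character modulo 3.  Once it is
  known, the divisibility is elementary.  For \<open>n = 30 m + 10\<close> and \<open>n = 30 m + 28\<close> the number \<open>n + 1\<close> is
  congruent to 2 modulo 3, so in every factorisation exactly one factor is 1 modulo 3 and the other
  one is 2 modulo 3.  Putting \<open>(j, k)\<close> and \<open>(k, j)\<close> together turns the sum into a sum of differences
  \<open>k\<^sup>2 - j\<^sup>2\<close>.  As \<open>n + 1\<close> is odd, prime to 3 and congruent to 1 or -1 modulo 5, each of them is
  divisible by 8, by 3 and by 5.

  The formula says that \<open>T(q)\<^sup>3\<close>, for the generating function \<open>T\<close> of 3-cores, is an Eisenstein series
  of weight 3.  It is proved for real \<open>0 < q < 1\<close> in three steps, after which the coefficients of the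
  two power series are compared.

  First, 3-cores.  The first-column hook lengths of a partition determine it, and the partition is a
  3-core iff this set of positive integers is closed under subtracting 3.  Such a set consists of an
  initial segment of each of the progressions 1, 4, 7, ... and 2, 5, 8, ..., so that 3-cores
  correspond to pairs \<open>(a, b)\<close> of natural numbers and the size becomes \<open>a\<^sup>2 - a b + b\<^sup>2 + b\<close>
  (\<open>bij_betw_core3_coords\<close>, \<open>sum_list_core3\<close>).

  Second, \<open>T\<close> is the Lambert series \<open>L\<close>, the sum of \<open>q\<^sup>n / (1 - q\<^bsup>3n+1\<^esup>)\<close> over all integers \<open>n\<close>
  (\<open>core3_sum_eq_lambert\<close>).  Write \<open>w = q\<^sup>3\<close>.  Both series, multiplied by \<open>(1 - q) (1 - q\<^sup>2) \<dots>\<close>, give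
  the cube of \<open>(1 - w) (1 - w\<^sup>2) \<dots>\<close>.  For \<open>T\<close> this follows by shifting the beads of a core along its
  three runners, which expresses \<open>T\<close> by three theta functions in \<open>w\<close> and one in \<open>q\<close>, and from the
  Jacobi triple product.  For \<open>L\<close> the theta function is divided by each of its linear factors; the
  coefficients of the quotients are values of a partial theta function and depend only on a
  difference of indices, so that the double sum factors (\<open>sum_theta_quotient\<close>).

  Third, the cube of \<open>L\<close>.  With \<open>A\<^sub>n = 1 / (1 - q\<^bsup>3n+1\<^esup>)\<close>, the product \<open>A\<^sub>n A\<^sub>m\<close> is for \<open>n \<noteq> m\<close> a linear
  combination of \<open>A\<^sub>n\<close> and \<open>A\<^sub>m\<close> whose coefficients depend on \<open>m - n\<close> only.  Summed along each line
  \<open>m - n = k \<noteq> 0\<close> everything cancels, and only the diagonal remains.  Done twice, this gives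
  \<open>L\<^sup>3\<close> as the sum of \<open>q\<^bsup>3n\<^esup> (2 A\<^sub>n\<^sup>3 - A\<^sub>n\<^sup>2)\<close> (\<open>pole_sum_1_1_cubed\<close>), and expanding the terms
  as power series yields the sum of \<open>chi3 j * k\<^sup>2\<close> over factorisations.
\<close>

section \<open>Unordered sums of real functions\<close>

lemma summable_on_int_split:
  fixes f :: "int \<Rightarrow> real"
  assumes "(\<lambda>n::nat. f (int n)) summable_on UNIV" "(\<lambda>n::nat. f (- int n)) summable_on UNIV"
  shows "f summable_on UNIV"
proof -
  have "f summable_on range int"
    using assms(1) by (subst summable_on_reindex) (auto simp: o_def inj_on_def)
  moreover have "f summable_on range (\<lambda>n. - int n)"
    using assms(2) by (subst summable_on_reindex) (auto simp: o_def inj_on_def)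
  ultimately have "f summable_on (range int \<union> range (\<lambda>n. - int n))"
    by (rule summable_on_union)
  moreover have "range int \<union> range (\<lambda>n. - int n) = UNIV"
  proof -
    have "x \<in> range int \<union> range (\<lambda>n. - int n)" for x
      by (cases x rule: int_cases2) auto
    then show ?thesis by blast
  qed
  ultimately show ?thesis by simp
qed

lemma summable_on_bounded_by:
  fixes f g :: "'a \<Rightarrow> real"
  assumes "g summable_on A" "\<And>x. x \<in> A \<Longrightarrow> \<bar>f x\<bar> \<le> g x"
  shows "f summable_on A"
proof -
  have "(\<lambda>x. \<bar>f x\<bar>) summable_on A"
    by (rule summable_on_comparison_test[OF assms(1)]) (use assms(2) in auto)
  then show ?thesis
    unfolding real_norm_def[symmetric] by (rule summable_on_iff_abs_summable_on_real[THEN iffD2])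
qed

lemma summable_on_int_geometric:
  fixes f :: "int \<Rightarrow> real"
  assumes "0 \<le> r" "r < 1" "\<And>n. \<bar>f (int n)\<bar> \<le> C * r ^ n" "\<And>n. \<bar>f (- int n)\<bar> \<le> C * r ^ n"
  shows "f summable_on UNIV"
proof -
  have "summable (\<lambda>n. norm (C * r ^ n))"
    using assms(1,2) by (simp add: abs_mult summable_mult)
  then have "(\<lambda>n. C * r ^ n) summable_on UNIV" by (rule norm_summable_imp_summable_on)
  then show ?thesis
    using assms by (intro summable_on_int_split) (auto intro: summable_on_bounded_by)
qed

text \<open>
Unordered sums are integrals for the counting measure, so this is Lebesgue's theorem.
\<close>

lemma infsum_dominated_convergence:
  fixes f :: "nat \<Rightarrow> 'a \<Rightarrow> real"
  assumes "g summable_on A"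
    and bound: "\<And>N x. x \<in> A \<Longrightarrow> \<bar>f N x\<bar> \<le> g x"
    and lim: "\<And>x. x \<in> A \<Longrightarrow> (\<lambda>N. f N x) \<longlonglongrightarrow> h x"
  shows "(\<lambda>N. infsum (f N) A) \<longlonglongrightarrow> infsum h A"
proof -
  have h: "\<bar>h x\<bar> \<le> g x" if "x \<in> A" for x
    using tendsto_rabs[OF lim[OF that]] bound[OF that] by (intro LIMSEQ_le_const2) auto
  have eq: "infsum u A = integral\<^sup>L (count_space A) u"
    if "\<And>x. x \<in> A \<Longrightarrow> \<bar>u x\<bar> \<le> g x" for u :: "'a \<Rightarrow> real"
  proof -
    have "u summable_on A" using summable_on_bounded_by[OF assms(1)] that by blast
    then have "Infinite_Set_Sum.abs_summable_on u A"
      using summable_on_iff_abs_summable_on_real abs_summable_equivalent by blast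
    then have "infsetsum u A = infsum u A" by (rule infsetsum_infsum)
    then show ?thesis by (simp add: infsetsum_def)
  qed
  have "Infinite_Set_Sum.abs_summable_on g A"
    using assms(1) summable_on_iff_abs_summable_on_real abs_summable_equivalent by blast
  then have "integrable (count_space A) g" by (simp add: abs_summable_on_def)
  then have "(\<lambda>N. integral\<^sup>L (count_space A) (f N)) \<longlonglongrightarrow> integral\<^sup>L (count_space A) h"
    by (intro integral_dominated_convergence[where w = g]) (auto simp: AE_count_space lim bound)
  then show ?thesis using eq[OF bound] eq[OF h] by simp
qed

lemma infsum_product:
  fixes f :: "'a \<Rightarrow> real" and g :: "'b \<Rightarrow> real"
  assumes "f summable_on A" "g summable_on B"
  shows "(\<lambda>(x, y). f x * g y) summable_on A \<times> B"
    and "infsum (\<lambda>(x, y). f x * g y) (A \<times> B) = infsum f A * infsum g B"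
proof -
  have f: "(\<lambda>x. norm (f x)) summable_on A" and g: "(\<lambda>x. norm (g x)) summable_on B"
    by (rule summable_on_iff_abs_summable_on_real[THEN iffD1, OF assms(1)],
        rule summable_on_iff_abs_summable_on_real[THEN iffD1, OF assms(2)])
  have "(\<lambda>p. norm (case p of (x, y) \<Rightarrow> f x * g y)) summable_on A \<times> B"
    unfolding Infinite_Sum.abs_summable_on_Sigma_iff
    using summable_on_cmult_left[OF f, of "\<Sum>\<^sub>\<infinity>x\<in>B. \<bar>g x\<bar>"] summable_on_cmult_right[OF g]
    by (simp add: abs_mult infsum_cmult_right' infsum_nonneg)
  then show s: "(\<lambda>(x, y). f x * g y) summable_on A \<times> B"
    by (rule summable_on_iff_abs_summable_on_real[THEN iffD2])
  show "infsum (\<lambda>(x, y). f x * g y) (A \<times> B) = infsum f A * infsum g B"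
    by (subst infsum_Sigma'_banach[OF s, symmetric]) (simp add: infsum_cmult_right' infsum_cmult_left')
qed

lemma geometric_has_sum:
  fixes c :: real
  assumes "\<bar>c\<bar> < 1"
  shows "((\<lambda>n. c ^ n) has_sum 1 / (1 - c)) UNIV"
proof (rule norm_summable_imp_has_sum)
  show "summable (\<lambda>n. norm (c ^ n))" unfolding norm_power by (intro summable_geometric) (use assms in simp)
  show "(\<lambda>n. c ^ n) sums (1 / (1 - c))" using assms by (intro geometric_sums) simp
qed

text \<open>
Used twice to read off a power series: the weight \<open>d\<close> is the size of a triple of cores, or the
product of a pair of positive integers.
\<close>

lemma has_sum_group_by:
  fixes f :: "'a \<Rightarrow> real" and d :: "'a \<Rightarrow> nat"
  assumes f: "f summable_on X"
    and fin: "\<And>n. finite {x \<in> X. d x = n}"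
  shows "((\<lambda>n. \<Sum>x\<in>{x \<in> X. d x = n}. f x) has_sum infsum f X) UNIV"
proof -
  let ?B = "\<lambda>n. {x \<in> X. d x = n}"
  have bij: "bij_betw snd (Sigma UNIV ?B) X"
    by (rule bij_betwI[of _ _ _ "\<lambda>x. (d x, x)"]) auto
  have S: "(\<lambda>(n, x). f x) summable_on Sigma UNIV ?B"
    using summable_on_reindex_bij_betw[OF bij, of f] f by (simp add: case_prod_unfold)
  have I: "infsum (\<lambda>(n, x). f x) (Sigma UNIV ?B) = infsum f X"
    using infsum_reindex_bij_betw[OF bij, of f] by (simp add: case_prod_unfold)
  have inner: "infsum f (?B n) = (\<Sum>x\<in>?B n. f x)" for n
    using fin by simp
  have "(\<lambda>n. infsum f (?B n)) summable_on UNIV" "infsum (\<lambda>n. infsum f (?B n)) UNIV = infsum f X"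
    using summable_on_Sigma_banach[OF S] infsum_Sigma'_banach[OF S] I by auto
  then show ?thesis unfolding inner by (simp add: has_sum_iff)
qed

section \<open>Infinite products and the Jacobi triple product\<close>

text \<open>
In the usual notation this is the infinite q-Pochhammer symbol \<open>(-x; q)\<close>.  With the plus sign the
factors of the triple product need no signs; Euler's product \<open>(1 - q) (1 - q\<^sup>2) \<dots>\<close> is \<open>qprod q (- q)\<close>.
\<close>

definition qprod :: "real \<Rightarrow> real \<Rightarrow> real" where
  "qprod q x = (\<Prod>i. 1 + x * q ^ i)"

lemma convergent_qprod:
  fixes q :: real
  assumes q: "0 < q" "q < 1"
  shows "convergent_prod (\<lambda>i. 1 + x * q ^ i)"
proof -
  have "summable (\<lambda>i. \<bar>x\<bar> * q ^ i)" using q by (intro summable_mult summable_geometric) auto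
  then have "summable (\<lambda>i. norm (1 + x * q ^ i - 1))" using q by (simp add: abs_mult)
  then have "abs_convergent_prod (\<lambda>i. 1 + x * q ^ i)"
    using abs_convergent_prod_conv_summable by blast
  then show ?thesis by (rule abs_convergent_prod_imp_convergent_prod)
qed

lemma qprod_lim:
  fixes q :: real
  assumes q: "0 < q" "q < 1"
  shows "(\<lambda>n. \<Prod>i<n. 1 + x * q ^ i) \<longlonglongrightarrow> qprod q x"
  unfolding qprod_def LIMSEQ_lessThan_iff_atMost
  by (rule convergent_prod_LIMSEQ[OF convergent_qprod[OF q]])

lemma qprod_pos:
  fixes q :: real
  assumes q: "0 < q" "q < 1"
    and "-1 < x"
  shows "0 < qprod q x"
proof -
  have pos: "0 < 1 + x * q ^ i" for i
  proof (cases "0 \<le> x")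
    case False
    have "q ^ i \<le> 1" using q by (simp add: power_le_one)
    then have "(- x) * q ^ i \<le> (- x) * 1" using False by (intro mult_left_mono) auto
    then show ?thesis using assms by simp
  qed (use q in \<open>simp add: add_pos_nonneg\<close>)
  have "qprod q x \<noteq> 0" unfolding qprod_def
    using pos by (intro prodinf_nonzero[OF convergent_qprod[OF q]]) (metis less_irrefl)
  moreover have "0 \<le> qprod q x"
    by (rule LIMSEQ_le_const[OF qprod_lim[OF q]]) (intro exI allI impI prod_nonneg less_imp_le[OF pos])
  ultimately show ?thesis by simp
qed

lemma qprod_shift:
  fixes q :: real
  assumes q: "0 < q" "q < 1"
  shows "qprod q x = (1 + x) * qprod q (x * q)"
proof -
  have "(\<lambda>n. \<Prod>i<Suc n. 1 + x * q ^ i) \<longlonglongrightarrow> qprod q x"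
    using LIMSEQ_Suc[OF qprod_lim[OF q]] .
  moreover have "(\<lambda>n. \<Prod>i<Suc n. 1 + x * q ^ i) \<longlonglongrightarrow> (1 + x) * qprod q (x * q)"
    unfolding prod.lessThan_Suc_shift using tendsto_mult_left[OF qprod_lim[OF q, of "x * q"], of "1 + x"]
    by (simp add: mult_ac)
  ultimately show ?thesis by (rule LIMSEQ_unique)
qed

text \<open>
All factors lie in the unit interval, and on it a product depends on each factor with Lipschitz
constant 1.  This gives the continuity that is needed for a limit at \<open>x = 1\<close> below.
\<close>

lemma qprod_lipschitz:
  fixes q :: real
  assumes q: "0 < q" "q < 1"
    and "0 \<le> x" "x \<le> 1" "0 \<le> y" "y \<le> 1"
  shows "\<bar>qprod q (- x) - qprod q (- y)\<bar> \<le> \<bar>x - y\<bar> / (1 - q)"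
proof -
  have unit: "norm (1 + - z * q ^ i) \<le> 1" if "0 \<le> z" "z \<le> 1" for z i
  proof -
    have "q ^ i \<le> 1" using q by (simp add: power_le_one)
    then have "z * q ^ i \<le> 1 * 1" using that q by (intro mult_mono) auto
    then show ?thesis using that q by (simp add: abs_le_iff)
  qed
  have "\<bar>(\<Prod>i<n. 1 + - x * q ^ i) - (\<Prod>i<n. 1 + - y * q ^ i)\<bar> \<le> \<bar>x - y\<bar> / (1 - q)" for n
  proof -
    have "\<bar>(\<Prod>i<n. 1 + - x * q ^ i) - (\<Prod>i<n. 1 + - y * q ^ i)\<bar>
        \<le> (\<Sum>i<n. norm ((1 + - x * q ^ i) - (1 + - y * q ^ i)))"
      unfolding real_norm_def[symmetric] using unit assms by (intro norm_prod_diff) auto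
    also have "\<dots> = (\<Sum>i<n. \<bar>x - y\<bar> * q ^ i)"
    proof (rule sum.cong)
      fix i
      have "(1 + - x * q ^ i) - (1 + - y * q ^ i) = (y - x) * q ^ i" by (simp add: algebra_simps)
      then show "norm ((1 + - x * q ^ i) - (1 + - y * q ^ i)) = \<bar>x - y\<bar> * q ^ i"
        using q by (simp add: abs_mult abs_minus_commute)
    qed simp
    also have "\<dots> \<le> \<bar>x - y\<bar> * (1 / (1 - q))"
    proof -
      have "(\<Sum>i<n. q ^ i) \<le> suminf (\<lambda>i. q ^ i)"
        using q by (intro sum_le_suminf) (auto intro: summable_geometric)
      then have "(\<Sum>i<n. q ^ i) \<le> 1 / (1 - q)" using q by (simp add: suminf_geometric)
      then show ?thesis unfolding sum_distrib_left[symmetric] by (intro mult_left_mono) auto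
    qed
    finally show ?thesis by simp
  qed
  then show ?thesis
    by (intro LIMSEQ_le_const2[OF tendsto_rabs[OF tendsto_diff[OF qprod_lim[OF q] qprod_lim[OF q]]]]) auto
qed

lemma qprod_triple:
  assumes q: "0 < q" "q < (1::real)"
  shows "qprod q x = qprod (q ^ 3) x * qprod (q ^ 3) (x * q) * qprod (q ^ 3) (x * q ^ 2)"
proof -
  have w: "0 < q ^ 3" "q ^ 3 < 1" using q by (auto simp: power_less_one_iff)
  have "(\<Prod>i<3 * n. 1 + x * q ^ i) = (\<Prod>i<n. 1 + x * (q ^ 3) ^ i) *
      (\<Prod>i<n. 1 + x * q * (q ^ 3) ^ i) * (\<Prod>i<n. 1 + x * q ^ 2 * (q ^ 3) ^ i)" for n
  proof (induction n)
    case (Suc n)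
    have "{..<3 * Suc n} = insert (3 * n) (insert (3 * n + 1) (insert (3 * n + 2) {..<3 * n}))"
      by auto
    then have "(\<Prod>i<3 * Suc n. 1 + x * q ^ i) = (1 + x * q ^ (3 * n)) * (1 + x * q ^ (3 * n + 1)) *
        (1 + x * q ^ (3 * n + 2)) * (\<Prod>i<3 * n. 1 + x * q ^ i)" by simp
    note split = this
    have pow: "q ^ (3 * n) = (q ^ 3) ^ n" "q ^ (3 * n + 1) = q * (q ^ 3) ^ n"
      "q ^ (3 * n + 2) = q ^ 2 * (q ^ 3) ^ n"
      by (simp_all add: power_add power_mult power2_eq_square)
    show ?case unfolding split Suc.IH pow by (simp only: prod.lessThan_Suc mult_ac)
  qed simp
  moreover have "(\<lambda>n. \<Prod>i<3 * n. 1 + x * q ^ i) \<longlonglongrightarrow> qprod q x"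
    using LIMSEQ_subseq_LIMSEQ[OF qprod_lim[OF q, of x], of "\<lambda>n. 3 * n"]
    by (simp add: o_def strict_mono_def)
  moreover have "(\<lambda>n. (\<Prod>i<n. 1 + x * (q ^ 3) ^ i) *
      (\<Prod>i<n. 1 + x * q * (q ^ 3) ^ i) * (\<Prod>i<n. 1 + x * q ^ 2 * (q ^ 3) ^ i)) \<longlonglongrightarrow>
      qprod (q ^ 3) x * qprod (q ^ 3) (x * q) * qprod (q ^ 3) (x * q ^ 2)"
    by (intro tendsto_mult qprod_lim w)
  ultimately show ?thesis by (simp only: LIMSEQ_unique)
qed

text \<open>
The exponent of the theta function.  It is kept as an integer so that negative indices cause no case
distinctions.
\<close>

definition tri :: "int \<Rightarrow> int" where
  "tri k = k * (k - 1) div 2"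

lemma two_tri: "2 * tri k = k * (k - 1)"
  by (simp add: tri_def)

lemma tri_add: "tri (a + b) = tri a + tri b + a * b"
  using two_tri[of a] two_tri[of b] two_tri[of "a + b"] by (simp add: algebra_simps)

lemma tri_uminus: "tri (- k) = tri k + k"
  using two_tri[of k] two_tri[of "- k"] by (simp add: algebra_simps)

lemma tri_0 [simp]: "tri 0 = 0" and tri_1 [simp]: "tri 1 = 0"
  by (auto simp: tri_def)

definition theta :: "real \<Rightarrow> real \<Rightarrow> real" where
  "theta q y = (\<Sum>\<^sub>\<infinity>k. q powi tri k * y powi k)"

text \<open>
The finite product \<open>(1 - q) \<dots> (1 - q\<^sup>n)\<close>, written such that its limit is literally \<open>qprod q (- q)\<close>.
\<close>

definition qpoch :: "real \<Rightarrow> nat \<Rightarrow> real" where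
  "qpoch q n = (\<Prod>i<n. 1 + - q * q ^ i)"

definition qbinom :: "real \<Rightarrow> nat \<Rightarrow> nat \<Rightarrow> real" where
  "qbinom q n j = (if j \<le> n then qpoch q n / (qpoch q j * qpoch q (n - j)) else 0)"

lemma summable_theta_nat:
  fixes q :: real
  assumes q: "0 < q" "q < 1"
  shows "(\<lambda>k. q powi tri (int k) * y ^ k) summable_on UNIV"
proof -
  have step: "q powi tri (int (Suc k)) * y ^ Suc k = (q ^ k * y) * (q powi tri (int k) * y ^ k)" for k
    using tri_add[of "int k" 1] q by (simp add: power_int_add add.commute)
  have "(\<lambda>k. q ^ k * \<bar>y\<bar>) \<longlonglongrightarrow> 0 * \<bar>y\<bar>"
    using q by (intro tendsto_mult LIMSEQ_power_zero tendsto_const) auto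
  then have "eventually (\<lambda>k. q ^ k * \<bar>y\<bar> < 1 / 2) sequentially"
    by (rule order_tendstoD(2)) simp
  then obtain K where K: "\<And>k. k \<ge> K \<Longrightarrow> q ^ k * \<bar>y\<bar> < 1 / 2"
    by (auto simp: eventually_sequentially)
  have "summable (\<lambda>k. norm (q powi tri (int k) * y ^ k))"
  proof (rule summable_ratio_test[where c = "1 / 2" and N = K])
    fix k assume "k \<ge> K"
    then have "(q ^ k * \<bar>y\<bar>) * norm (q powi tri (int k) * y ^ k)
        \<le> 1 / 2 * norm (q powi tri (int k) * y ^ k)"
      using K by (intro mult_right_mono) (auto intro: less_imp_le)
    then show "norm (norm (q powi tri (int (Suc k)) * y ^ Suc k))
        \<le> 1 / 2 * norm (norm (q powi tri (int k) * y ^ k))"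
      unfolding step using q by (simp add: abs_mult)
  qed simp
  then show ?thesis by (rule norm_summable_imp_summable_on)
qed

lemma summable_theta:
  fixes q :: real
  assumes q: "0 < q" "q < 1"
    and "y \<noteq> 0"
  shows "(\<lambda>k. q powi tri k * y powi k) summable_on UNIV"
proof (rule summable_on_int_split)
  show "(\<lambda>n. q powi tri (int n) * y powi int n) summable_on UNIV"
    using summable_theta_nat[OF q, of y] by simp
  have "q powi tri (- int n) * y powi (- int n) = q powi tri (int n) * (q / y) ^ n" for n
    using q by (simp add: tri_uminus power_int_add power_int_minus power_divide field_simps)
  then show "(\<lambda>n. q powi tri (- int n) * y powi (- int n)) summable_on UNIV"
    using summable_theta_nat[OF q, of "q / y"] by simp
qed

lemma qpoch_pos:
  fixes q :: real
  assumes q: "0 < q" "q < 1"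
  shows "0 < qpoch q n"
  unfolding qpoch_def
proof (intro prod_pos ballI)
  fix i
  have "q * q ^ i < 1" using q by (simp add: power_Suc_less_one flip: power_Suc)
  then show "0 < 1 + - q * q ^ i" by simp
qed

lemma qpoch_Suc:
  fixes q :: real
  assumes q: "0 < q" "q < 1"
  shows "qpoch q (Suc n) = qpoch q n * (1 - q ^ Suc n)"
  by (simp add: qpoch_def)

lemma qbinom_Suc_Suc:
  fixes q :: real
  assumes q: "0 < q" "q < 1"
    and "j \<le> n"
  shows "qbinom q (Suc n) (Suc j) = qbinom q n (Suc j) + q ^ (n - j) * qbinom q n j"
proof (cases "j = n")
  case True
  then show ?thesis using qpoch_pos[OF q] by (simp add: qbinom_def qpoch_def[of q 0] less_imp_neq[symmetric])
next
  case False
  define d where "d = n - Suc j"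
  have n: "n = Suc (j + d)" using assms False by (simp add: d_def)
  have nz: "qpoch q i \<noteq> 0" for i using qpoch_pos[OF q, of i] by simp
  have nz': "1 - q ^ Suc i \<noteq> 0" for i using q power_Suc_less_one[of q i] by simp
  have "q ^ Suc (Suc (j + d)) = q ^ Suc j * q ^ Suc d" by (simp flip: power_add)
  then show ?thesis
    using nz[of j] nz[of d] nz[of "Suc (j + d)"] nz'[of j] nz'[of d]
    unfolding n qbinom_def
    by (simp add: qpoch_Suc[OF q, of "Suc (j + d)"] qpoch_Suc[OF q, of j] qpoch_Suc[OF q, of d] Suc_diff_le
        divide_simps del: power_Suc) (simp add: algebra_simps del: power_Suc)
qed

lemma q_binomial_theorem:
  fixes q :: real
  assumes q: "0 < q" "q < 1"
  shows "(\<Prod>i<n. 1 + t * q ^ i) = (\<Sum>j\<le>n. qbinom q n j * q powi tri (int j) * t ^ j)"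
proof (induction n)
  case 0
  then show ?case by (simp add: qbinom_def qpoch_def)
next
  case (Suc n)
  let ?g = "\<lambda>n j. qbinom q n j * q powi tri (int j) * t ^ j"
  have zero: "?g (Suc n) 0 = ?g n 0"
    using qpoch_pos[OF q] by (simp add: qbinom_def qpoch_def[of q 0] less_imp_neq[symmetric])
  have step: "?g (Suc n) (Suc j) = ?g n (Suc j) + t * q ^ n * ?g n j" if "j \<le> n" for j
  proof -
    have "q powi tri (int (Suc j)) = q powi tri (int j) * q ^ j"
      using tri_add[of "int j" 1] q by (simp add: power_int_add add.commute)
    moreover have "q ^ n = q ^ (n - j) * q ^ j" using that by (simp flip: power_add)
    ultimately show ?thesis using qbinom_Suc_Suc[OF q that] by (simp add: algebra_simps)
  qed
  have "(\<Sum>j\<le>n. ?g n j) = (\<Sum>j\<le>Suc n. ?g n j)"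
    by (simp add: qbinom_def)
  also have "\<dots> = ?g n 0 + (\<Sum>j\<le>n. ?g n (Suc j))"
    by (rule sum.atMost_Suc_shift)
  finally have split: "(\<Sum>j\<le>n. ?g n j) = ?g n 0 + (\<Sum>j\<le>n. ?g n (Suc j))" .
  have "(\<Prod>i<Suc n. 1 + t * q ^ i) = (\<Sum>j\<le>n. ?g n j) + t * q ^ n * (\<Sum>j\<le>n. ?g n j)"
    by (simp add: Suc.IH algebra_simps)
  also have "\<dots> = ?g n 0 + (\<Sum>j\<le>n. ?g n (Suc j)) + t * q ^ n * (\<Sum>j\<le>n. ?g n j)"
    by (subst (1) split) (rule refl)
  also have "?g n 0 + (\<Sum>j\<le>n. ?g n (Suc j)) + t * q ^ n * (\<Sum>j\<le>n. ?g n j) = ?g (Suc n) 0 + (\<Sum>j\<le>n. ?g (Suc n) (Suc j))"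
    unfolding zero using step by (simp add: sum.distrib sum_distrib_left)
  also have "\<dots> = (\<Sum>j\<le>Suc n. ?g (Suc n) j)"
    by (rule sum.atMost_Suc_shift[symmetric])
  finally show ?case .
qed

text \<open>
This is the q-binomial theorem for \<open>2 n\<close> factors at \<open>t = y / q\<^sup>n\<close>: the first \<open>n\<close> factors then
contain negative powers of \<open>q\<close>, and pulling these out turns them into the factors with \<open>q / y\<close>.
\<close>

lemma finite_triple_product:
  fixes q :: real
  assumes q: "0 < q" "q < 1"
    and "y \<noteq> 0"
  shows "(\<Prod>i<n. 1 + y * q ^ i) * (\<Prod>i<n. 1 + q / y * q ^ i) =
    (\<Sum>k\<in>{- int n..int n}. qbinom q (2 * n) (nat (k + int n)) * (q powi tri k * y powi k))"
proof -
  \<comment> \<open>The argument is chosen such that factor \<open>i + n\<close> of the q-binomial theorem is \<open>1 + y q\<^sup>i\<close>.\<close>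
  define t where "t = y * q powi (- int n)"
  have tq: "t * q ^ m = y * q powi (int m - int n)" for m
    using q by (simp add: t_def power_int_diff power_int_minus field_simps)
  have outer: "(\<Prod>i<n. t * q ^ (n - Suc i)) = y powi int n * q powi (- tri (int n + 1))"
  proof -
    have "(\<Prod>i<m. y * q powi (- int (Suc i))) = y powi int m * q powi (- tri (int m + 1))" for m
    proof (induction m)
      case (Suc m)
      have "tri (int (Suc m) + 1) = tri (int m + 1) + int (Suc m)"
        using tri_add[of "int m + 1" 1] by (simp add: add.commute)
      then have "q powi (- tri (int (Suc m) + 1)) = q powi (- tri (int m + 1)) * q powi (- int (Suc m))"
        using q by (simp add: power_int_add[symmetric] del: of_nat_Suc)
      then show ?case using Suc by (simp del: of_nat_Suc)
    qed simp
    moreover have "t * q ^ (n - Suc i) = y * q powi (- int (Suc i))" if "i < n" for i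
      using that by (simp add: tq of_nat_diff)
    ultimately show ?thesis by simp
  qed
  have "(\<Prod>i<2 * n. 1 + t * q ^ i) = (\<Prod>i<n. 1 + t * q ^ i) * (\<Prod>i<n. 1 + t * q ^ (i + n))"
  proof -
    have "{..<2 * n} = {..<n} \<union> {n..<2 * n}" by auto
    then have "(\<Prod>i<2 * n. 1 + t * q ^ i) = (\<Prod>i<n. 1 + t * q ^ i) * (\<Prod>i\<in>{n..<2 * n}. 1 + t * q ^ i)"
      by (simp add: prod.union_disjoint ivl_disj_int)
    also have "(\<Prod>i\<in>{n..<2 * n}. 1 + t * q ^ i) = (\<Prod>i\<in>{0..<n}. 1 + t * q ^ (i + n))"
      using prod.shift_bounds_nat_ivl[of "\<lambda>i. 1 + t * q ^ i" 0 n n] by (simp add: mult_2)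
    finally show ?thesis by (simp add: lessThan_atLeast0)
  qed
  also have "(\<Prod>i<n. 1 + t * q ^ (i + n)) = (\<Prod>i<n. 1 + y * q ^ i)"
    by (simp add: tq)
  also have "(\<Prod>i<n. 1 + t * q ^ i) = (\<Prod>i<n. 1 + t * q ^ (n - Suc i))"
    by (rule prod.nat_diff_reindex[symmetric])
  also have "\<dots> = (\<Prod>i<n. t * q ^ (n - Suc i) * (1 + q / y * q ^ i))"
  proof (rule prod.cong)
    fix i assume "i \<in> {..<n}"
    then have "t * q ^ (n - Suc i) = y * q powi (- int (Suc i))" by (simp add: tq of_nat_diff)
    then have "t * q ^ (n - Suc i) = y / q ^ Suc i"
      unfolding power_int_minus power_int_of_nat by (simp add: field_simps)
    then show "1 + t * q ^ (n - Suc i) = t * q ^ (n - Suc i) * (1 + q / y * q ^ i)"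
      using q assms by (simp add: field_simps)
  qed simp
  also have "\<dots> = y powi int n * q powi (- tri (int n + 1)) * (\<Prod>i<n. 1 + q / y * q ^ i)"
    unfolding outer[symmetric] by (rule prod.distrib)
  finally have "(\<Prod>i<n. 1 + y * q ^ i) * (\<Prod>i<n. 1 + q / y * q ^ i) =
      y powi (- int n) * q powi tri (int n + 1) * (\<Prod>i<2 * n. 1 + t * q ^ i)"
    using q assms by (simp add: power_int_minus field_simps)
  also have "\<dots> = (\<Sum>j\<le>2 * n. y powi (- int n) * q powi tri (int n + 1) *
      (qbinom q (2 * n) j * q powi tri (int j) * t ^ j))"
    unfolding q_binomial_theorem[OF q] sum_distrib_left ..
  also have "\<dots> = (\<Sum>j\<le>2 * n. qbinom q (2 * n) j *
      (q powi tri (int j - int n) * y powi (int j - int n)))"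
  proof (rule sum.cong)
    fix j
    have "tri (int j) = tri (int j - int n) + tri (int n) + (int j - int n) * int n"
      using tri_add[of "int j - int n" "int n"] by simp
    moreover have "tri (int n + 1) = tri (int n) + int n" using tri_add[of "int n" 1] by simp
    moreover have "2 * tri (int n) = int n * (int n - 1)" by (rule two_tri)
    ultimately have e: "tri (int n + 1) + tri (int j) + - int n * int j = tri (int j - int n)"
      by (simp add: algebra_simps)
    have "t ^ j = y powi int j * q powi (- int n * int j)"
      by (simp add: t_def power_mult_distrib power_int_power')
    moreover have "q powi tri (int j - int n) =
        q powi tri (int n + 1) * q powi tri (int j) * q powi (- int n * int j)"
      using q by (simp only: e[symmetric] power_int_add[OF disjI1[OF less_imp_neq[OF q(1), symmetric]]])
    moreover have "y powi (int j - int n) = y powi int j * y powi (- int n)"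
      using assms by (simp add: power_int_diff power_int_minus field_simps)
    ultimately show "y powi (- int n) * q powi tri (int n + 1) *
        (qbinom q (2 * n) j * q powi tri (int j) * t ^ j) =
      qbinom q (2 * n) j * (q powi tri (int j - int n) * y powi (int j - int n))"
      by (simp only: mult_ac)
  qed simp
  also have "\<dots> = (\<Sum>k\<in>{- int n..int n}. qbinom q (2 * n) (nat (k + int n)) * (q powi tri k * y powi k))"
    by (rule sum.reindex_bij_witness[of _ "\<lambda>k. nat (k + int n)" "\<lambda>j. int j - int n"]) auto
  finally show ?thesis .
qed

lemma qpoch_lim:
  fixes q :: real
  assumes q: "0 < q" "q < 1"
  shows "qpoch q \<longlonglongrightarrow> qprod q (- q)"
  unfolding qpoch_def[abs_def] by (rule qprod_lim[OF q])

lemma qpoch_ge: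
  fixes q :: real
  assumes q: "0 < q" "q < 1"
  shows "qprod q (- q) \<le> qpoch q n"
proof -
  have "decseq (qpoch q)"
  proof (rule decseq_SucI)
    fix n
    have "qpoch q n * (1 - q ^ Suc n) \<le> qpoch q n * 1"
      using q qpoch_pos[OF q, of n] by (intro mult_left_mono) auto
    then show "qpoch q (Suc n) \<le> qpoch q n" by (simp add: qpoch_Suc[OF q])
  qed
  then show ?thesis using qpoch_lim[OF q] by (rule decseq_ge)
qed

lemma qpoch_le_1:
  fixes q :: real
  assumes q: "0 < q" "q < 1"
  shows "qpoch q n \<le> 1"
  unfolding qpoch_def using q
  by (intro prod_le_1) (auto simp: power_le_one mult_le_one)

text \<open>
For fixed \<open>k\<close> the q-binomial coefficients of the finite version tend to the reciprocal of Euler's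
product, and they are bounded uniformly, so the limit may be taken termwise.
\<close>

theorem jacobi_triple_product:
  fixes q :: real
  assumes q: "0 < q" "q < 1"
    and "y \<noteq> 0"
  shows "theta q y = qprod q (- q) * qprod q y * qprod q (q / y)"
proof -
  define Q where "Q = qprod q (- q)"
  have Q: "0 < Q" unfolding Q_def using q by (intro qprod_pos[OF q]) auto
  let ?f = "\<lambda>k. q powi tri k * y powi k"
  define c where "c = (\<lambda>n k. if k \<in> {- int n..int n} then qbinom q (2 * n) (nat (k + int n)) else 0)"
  have eq: "infsum (\<lambda>k. c n k * ?f k) UNIV =
      (\<Prod>i<n. 1 + y * q ^ i) * (\<Prod>i<n. 1 + q / y * q ^ i)" for n
  proof -
    have "infsum (\<lambda>k. c n k * ?f k) UNIV = infsum (\<lambda>k. c n k * ?f k) {- int n..int n}"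
      by (rule infsum_cong_neutral) (auto simp: c_def)
    then show ?thesis unfolding finite_triple_product[OF assms] by (simp add: c_def)
  qed
  have bound: "\<bar>c n k\<bar> \<le> 1 / (Q * Q)" for n k
  proof -
    have "qpoch q m / (qpoch q i * qpoch q j) \<le> 1 / (Q * Q)" for m i j
      using Q qpoch_le_1[OF q] qpoch_ge[OF q] by (intro frac_le mult_mono) (auto simp: Q_def less_imp_le[OF qpoch_pos[OF q]])
    moreover have "0 \<le> qpoch q m / (qpoch q i * qpoch q j)" for m i j
      using qpoch_pos[OF q] by (simp add: less_imp_le)
    ultimately show ?thesis using Q by (auto simp: c_def qbinom_def)
  qed
  have lim: "(\<lambda>n. c n k) \<longlonglongrightarrow> 1 / Q" for k
  proof -
    have shift: "filterlim (\<lambda>n. nat (int n + j)) at_top sequentially" for j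
      unfolding filterlim_at_top eventually_sequentially
    proof
      fix Z show "\<exists>N. \<forall>n\<ge>N. Z \<le> nat (int n + j)"
        by (intro exI[of _ "Z + nat \<bar>j\<bar>"]) auto
    qed
    have "filterlim (\<lambda>n::nat. 2 * n) at_top sequentially"
      by (rule mult_nat_left_at_top) simp
    with shift[of k] shift[of "- k"] have "(\<lambda>n. qpoch q (2 * n) / (qpoch q (nat (int n + k)) * qpoch q (nat (int n - k))))
        \<longlonglongrightarrow> Q / (Q * Q)"
      using Q unfolding Q_def by (intro tendsto_intros filterlim_compose[OF qpoch_lim[OF q]]) auto
    moreover have "eventually (\<lambda>n. qpoch q (2 * n) / (qpoch q (nat (int n + k)) * qpoch q (nat (int n - k))) = c n k) sequentially"
      using eventually_ge_at_top[of "nat \<bar>k\<bar>"]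
    proof eventually_elim
      case (elim n)
      then have "2 * n - nat (k + int n) = nat (int n - k)" "nat (k + int n) \<le> 2 * n"
        "k \<in> {- int n..int n}" by auto
      then show ?case by (simp add: c_def qbinom_def add.commute)
    qed
    ultimately show ?thesis using Q by (simp add: Lim_transform_eventually)
  qed
  have "(\<lambda>n. infsum (\<lambda>k. c n k * ?f k) UNIV) \<longlonglongrightarrow> infsum (\<lambda>k. 1 / Q * ?f k) UNIV"
  proof (rule infsum_dominated_convergence[where g = "\<lambda>k. 1 / (Q * Q) * \<bar>?f k\<bar>"])
    have "(\<lambda>k. norm (?f k)) summable_on UNIV"
      using summable_theta[OF assms] by (rule summable_on_iff_abs_summable_on_real[THEN iffD1])
    then show "(\<lambda>k. 1 / (Q * Q) * \<bar>?f k\<bar>) summable_on UNIV"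
      unfolding real_norm_def by (rule summable_on_cmult_right)
    show "\<bar>c n k * ?f k\<bar> \<le> 1 / (Q * Q) * \<bar>?f k\<bar>" for n k
      unfolding abs_mult[of "c n k"] using bound by (intro mult_right_mono) auto
    show "(\<lambda>n. c n k * ?f k) \<longlonglongrightarrow> 1 / Q * ?f k" for k
      by (intro tendsto_mult lim tendsto_const)
  qed
  moreover have "(\<lambda>n. infsum (\<lambda>k. c n k * ?f k) UNIV) \<longlonglongrightarrow> qprod q y * qprod q (q / y)"
    unfolding eq by (intro tendsto_mult qprod_lim[OF q])
  ultimately have "1 / Q * theta q y = qprod q y * qprod q (q / y)"
    unfolding theta_def infsum_cmult_right' by (rule LIMSEQ_unique)
  then show ?thesis using Q by (simp add: Q_def field_simps)
qed

section \<open>A Lambert series as an infinite product\<close>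

text \<open>
One half of the theta series.  Its values at integral powers of \<open>q\<close> are the coefficients that appear
when a theta function is divided by one of its linear factors.
\<close>

definition partial_theta :: "real \<Rightarrow> real \<Rightarrow> real" where
  "partial_theta q y = (\<Sum>\<^sub>\<infinity>k::nat. q powi tri (int k) * (- y) ^ k)"

lemma powi_add_q:
  fixes q :: real
  assumes q: "0 < q" "q < 1"
  shows "q powi (a + b) = q powi a * q powi b"
  using q by (simp add: power_int_add)

text \<open>
The exponents satisfy \<open>tri (k + 1) = tri k + k\<close>, so dropping the term for \<open>k = 0\<close> rescales the argument
by \<open>q\<close>.
\<close>

lemma partial_theta_rec:
  fixes q :: real
  assumes q: "0 < q" "q < 1"
  shows "partial_theta q y = 1 - y * partial_theta q (q * y)"
proof -
  let ?f = "\<lambda>k. q powi tri (int k) * (- y) ^ k"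
  have "partial_theta q y = infsum ?f (insert 0 (range Suc))"
    unfolding partial_theta_def by (rule arg_cong[of _ _ "infsum ?f"]) (auto simp: image_iff, metis not0_implies_Suc)
  also have "\<dots> = ?f 0 + infsum ?f (range Suc)"
    using summable_theta_nat[OF q, of "- y"]
    by (subst infsum_Un_disjoint[of ?f "{0}" "range Suc", simplified])
       (auto intro: summable_on_subset_banach)
  also have "infsum ?f (range Suc) = infsum (\<lambda>k. ?f (Suc k)) UNIV"
    by (subst infsum_reindex) (auto simp: o_def)
  also have "\<dots> = infsum (\<lambda>k. - y * (q powi tri (int k) * (- (q * y)) ^ k)) UNIV"
  proof (rule infsum_cong)
    fix k :: nat
    have "q powi tri (int (Suc k)) = q powi tri (int k) * q ^ k"
      using tri_add[of "int k" 1] by (simp add: powi_add_q[OF q] add.commute)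
    moreover have "(- (q * y)) ^ k = q ^ k * (- y) ^ k"
      by (metis mult_minus_right power_mult_distrib)
    ultimately show "?f (Suc k) = - y * (q powi tri (int k) * (- (q * y)) ^ k)"
      by (simp add: mult_ac)
  qed
  also have "\<dots> = - y * partial_theta q (q * y)"
    unfolding partial_theta_def by (rule infsum_cmult_right')
  finally show ?thesis by simp
qed

text \<open>
At \<open>y = -1\<close> all terms are positive and dominate those for \<open>0 \<le> y \<le> 1\<close>.
\<close>

definition ptheta_bound :: "real \<Rightarrow> real" where
  "ptheta_bound q = partial_theta q (- 1)"

lemma ptheta_bound_nonneg:
  fixes q :: real
  assumes q: "0 < q" "q < 1"
  shows "0 \<le> ptheta_bound q"
  unfolding ptheta_bound_def partial_theta_def using q by (intro infsum_nonneg) simp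

lemma partial_theta_le:
  fixes q :: real
  assumes q: "0 < q" "q < 1"
    and "0 \<le> y" "y \<le> 1"
  shows "\<bar>partial_theta q y\<bar> \<le> ptheta_bound q"
  unfolding real_norm_def[symmetric]
proof (rule norm_infsum_le)
  show "((\<lambda>k. q powi tri (int k) * (- y) ^ k) has_sum partial_theta q y) UNIV"
    unfolding partial_theta_def using summable_theta_nat[OF q] by (rule has_sum_infsum)
  show "((\<lambda>k. q powi tri (int k) * 1 ^ k) has_sum ptheta_bound q) UNIV"
    unfolding partial_theta_def ptheta_bound_def using has_sum_infsum[OF summable_theta_nat[OF q, of 1]]
    by simp
  fix k :: nat
  show "norm (q powi tri (int k) * (- y) ^ k) \<le> q powi tri (int k) * 1 ^ k"
    using assms q by (simp add: abs_mult power_abs power_le_one)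
qed

abbreviation shifted_ptheta :: "real \<Rightarrow> int \<Rightarrow> real" where
  "shifted_ptheta q m \<equiv> partial_theta q (q powi m)"

lemma shifted_ptheta_rec:
  fixes q :: real
  assumes q: "0 < q" "q < 1"
  shows "shifted_ptheta q m + q powi m * shifted_ptheta q (m + 1) = 1"
  using partial_theta_rec[OF q, of "q powi m"] powi_add_q[OF q, of m 1] by (simp add: mult.commute)

text \<open>
Only this reflection shows that the coefficients decay at negative indices: the defining series has
large terms there, which cancel.
\<close>

lemma shifted_ptheta_reflect:
  fixes q :: real
  assumes q: "0 < q" "q < 1"
  shows "shifted_ptheta q (1 - int n) = q ^ n * shifted_ptheta q (1 + int n)"
proof (induction n)
  case (Suc n)
  have "shifted_ptheta q (1 - int (Suc n)) = 1 - q powi (- int n) * shifted_ptheta q (1 - int n)"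
    using shifted_ptheta_rec[OF q, of "- int n"] by (simp add: algebra_simps)
  also have "\<dots> = 1 - shifted_ptheta q (1 + int n)"
    unfolding Suc.IH using q by (simp add: power_int_minus)
  also have "\<dots> = q powi (1 + int n) * shifted_ptheta q (1 + int n + 1)"
    using shifted_ptheta_rec[OF q, of "1 + int n"] by simp
  finally show ?case by (simp add: powi_add_q[OF q] algebra_simps)
qed simp

lemma shifted_ptheta_bound_nonneg:
  fixes q :: real
  assumes q: "0 < q" "q < 1"
  shows "\<bar>shifted_ptheta q (int n)\<bar> \<le> ptheta_bound q"
  using q by (intro partial_theta_le[OF q]) (auto simp: power_le_one)

lemma shifted_ptheta_bound_neg:
  fixes q :: real
  assumes q: "0 < q" "q < 1"
  shows "\<bar>shifted_ptheta q (1 - int n)\<bar> \<le> ptheta_bound q * q ^ n"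
  unfolding shifted_ptheta_reflect[OF q] using q shifted_ptheta_bound_nonneg[OF q, of "Suc n"]
  by (simp add: abs_mult mult.commute)

lemma shifted_ptheta_bound:
  fixes q :: real
  assumes q: "0 < q" "q < 1"
  shows "\<bar>shifted_ptheta q m\<bar> \<le> ptheta_bound q"
proof (cases "0 \<le> m")
  case True
  then show ?thesis using shifted_ptheta_bound_nonneg[OF q, of "nat m"] by simp
next
  case False
  then have "\<bar>shifted_ptheta q m\<bar> \<le> ptheta_bound q * q ^ nat (1 - m)" using shifted_ptheta_bound_neg[OF q, of "nat (1 - m)"] by simp
  also have "\<dots> \<le> ptheta_bound q * 1"
    using q ptheta_bound_nonneg[OF q] by (intro mult_left_mono power_le_one) auto
  finally show ?thesis by simp
qed

text \<open>
The Laurent series of \<open>theta q (- z) / (1 - z q\<^sup>n)\<close>; the lemma of the same name below justifies this.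
In contrast to the quotient it also makes sense where the denominator vanishes, and its value there
is what determines the constant in the product formula.
\<close>

definition theta_quotient :: "real \<Rightarrow> int \<Rightarrow> real \<Rightarrow> real" where
  "theta_quotient q n z = (\<Sum>\<^sub>\<infinity>j. q powi tri j * (- z) powi j * shifted_ptheta q (n - j + 1))"

lemma theta_quotient_summable:
  fixes q :: real
  assumes q: "0 < q" "q < 1"
    and "z \<noteq> 0"
  shows "(\<lambda>j. q powi tri j * (- z) powi j * shifted_ptheta q (n - j + 1)) summable_on UNIV"
proof (rule summable_on_bounded_by)
  have "(\<lambda>j. norm (q powi tri j * (- z) powi j)) summable_on UNIV"
    using summable_theta[OF q, of "- z"] assms
    by (intro summable_on_iff_abs_summable_on_real[THEN iffD1]) auto
  then show "(\<lambda>j. norm (q powi tri j * (- z) powi j) * ptheta_bound q) summable_on UNIV"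
    by (rule summable_on_cmult_left)
  show "\<bar>q powi tri j * (- z) powi j * shifted_ptheta q (n - j + 1)\<bar>
      \<le> norm (q powi tri j * (- z) powi j) * ptheta_bound q" for j
    using shifted_ptheta_bound[OF q] by (simp only: abs_mult real_norm_def) (intro mult_left_mono; simp)
qed

lemma theta_quotient:
  fixes q :: real
  assumes q: "0 < q" "q < 1"
    and "z \<noteq> 0"
  shows "(1 - z * q powi n) * theta_quotient q n z = theta q (- z)"
proof -
  define a where "a = (\<lambda>j. q powi tri j * (- z) powi j)"
  have a: "z * q powi n * a (j - 1) = - (q powi (n - j + 1)) * a j" for j
  proof -
    have "tri j = tri (j - 1) + (j - 1)" using tri_add[of "j - 1" 1] by simp
    then have "q powi tri j = q powi tri (j - 1) * q powi (j - 1)" by (simp add: powi_add_q[OF q])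
    moreover have "(- z) powi j = (- z) powi (j - 1) * (- z)"
      by (rule power_int_minus_mult[symmetric]) (use assms in simp)
    moreover have "q powi n = q powi (n - j + 1) * q powi (j - 1)"
      by (simp flip: powi_add_q[OF q])
    ultimately show ?thesis by (simp add: a_def)
  qed
  have s: "(\<lambda>j. a j * shifted_ptheta q (n - j + 1)) summable_on UNIV"
    unfolding a_def by (rule theta_quotient_summable[OF assms])
  have bij: "bij_betw (\<lambda>j::int. j - 1) UNIV UNIV"
    by (rule bij_betwI[of _ _ _ "\<lambda>j. j + 1"]) auto
  \<comment> \<open>Multiplication by \<open>z q\<^sup>n\<close> shifts the index by one, and the recursion for \<open>shifted_ptheta\<close> then adds
    up the two series termwise.\<close>
  have shift: "(\<lambda>j. z * q powi n * (a (j - 1) * shifted_ptheta q (n - (j - 1) + 1))) summable_on UNIV"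
    using summable_on_reindex_bij_betw[OF bij, of "\<lambda>j. z * q powi n * (a j * shifted_ptheta q (n - j + 1))"]
      summable_on_cmult_right[OF s, of "z * q powi n"] by simp
  have e: "z * q powi n * (a (j - 1) * shifted_ptheta q (n - (j - 1) + 1)) = - (q powi (n - j + 1) * a j * shifted_ptheta q (n - j + 2))" for j
  proof -
    have "n - (j - 1) + 1 = n - j + 2" by simp
    moreover have "z * q powi n * (a (j - 1) * P) = - (q powi (n - j + 1) * a j * P)" for P
      unfolding mult.assoc[of _ _ P, symmetric] a by simp
    ultimately show ?thesis by (simp only:)
  qed
  have "z * q powi n * theta_quotient q n z = (\<Sum>\<^sub>\<infinity>j. z * q powi n * (a j * shifted_ptheta q (n - j + 1)))"
    by (simp add: theta_quotient_def a_def infsum_cmult_right')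
  also have "\<dots> = (\<Sum>\<^sub>\<infinity>j. - (q powi (n - j + 1) * a j * shifted_ptheta q (n - j + 2)))"
    unfolding infsum_reindex_bij_betw[OF bij, symmetric, of "\<lambda>j. z * q powi n * (a j * shifted_ptheta q (n - j + 1))"] e ..
  also have "\<dots> = - (\<Sum>\<^sub>\<infinity>j. q powi (n - j + 1) * a j * shifted_ptheta q (n - j + 2))"
    by (rule infsum_uminus)
  finally have rest: "theta_quotient q n z - z * q powi n * theta_quotient q n z =
      theta_quotient q n z + (\<Sum>\<^sub>\<infinity>j. q powi (n - j + 1) * a j * shifted_ptheta q (n - j + 2))"
    by linarith
  have "theta_quotient q n z = (\<Sum>\<^sub>\<infinity>j. a j * shifted_ptheta q (n - j + 1))"
    by (simp only: theta_quotient_def a_def)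
  with rest have "theta_quotient q n z - z * q powi n * theta_quotient q n z =
      (\<Sum>\<^sub>\<infinity>j. a j * shifted_ptheta q (n - j + 1)) + (\<Sum>\<^sub>\<infinity>j. q powi (n - j + 1) * a j * shifted_ptheta q (n - j + 2))"
    by linarith
  also have "\<dots> = (\<Sum>\<^sub>\<infinity>j. a j * shifted_ptheta q (n - j + 1) + q powi (n - j + 1) * a j * shifted_ptheta q (n - j + 2))"
    using s shift unfolding e summable_on_uminus by (intro infsum_add[symmetric])
  also have "\<dots> = (\<Sum>\<^sub>\<infinity>j. a j)"
  proof (rule infsum_cong)
    fix j
    have "a j * shifted_ptheta q (n - j + 1) + q powi (n - j + 1) * a j * shifted_ptheta q (n - j + 2) =
        a j * (shifted_ptheta q (n - j + 1) + q powi (n - j + 1) * shifted_ptheta q (n - j + 1 + 1))"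
      by (simp add: algebra_simps)
    then show "a j * shifted_ptheta q (n - j + 1) + q powi (n - j + 1) * a j * shifted_ptheta q (n - j + 2) = a j"
      unfolding shifted_ptheta_rec[OF q] by simp
  qed
  finally have "theta_quotient q n z - z * q powi n * theta_quotient q n z = (\<Sum>\<^sub>\<infinity>j. a j)" .
  moreover have "(\<Sum>\<^sub>\<infinity>j. a j) = theta q (- z)" by (simp only: theta_def a_def)
  ultimately show ?thesis by (simp only: left_diff_distrib mult_1)
qed

definition ptheta_series :: "real \<Rightarrow> real \<Rightarrow> real" where
  "ptheta_series q x = (\<Sum>\<^sub>\<infinity>m. x powi m * shifted_ptheta q (m + 1))"

lemma ptheta_series_summable:
  fixes q :: real
  assumes q: "0 < q" "q < 1"
    and "q < x" "x < 1"
  shows "(\<lambda>m. x powi m * shifted_ptheta q (m + 1)) summable_on UNIV"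
proof (rule summable_on_int_geometric)
  define r where "r = max x (q / x)"
  have x: "0 < x" using assms q by simp
  show "0 \<le> r" "r < 1" using assms q x by (auto simp: r_def)
  fix n :: nat
  have "\<bar>x powi int n * shifted_ptheta q (int n + 1)\<bar> \<le> x ^ n * ptheta_bound q"
    using x shifted_ptheta_bound[OF q] by (simp add: abs_mult mult_left_mono)
  also have "\<dots> \<le> r ^ n * ptheta_bound q"
    using x ptheta_bound_nonneg[OF q] by (intro mult_right_mono power_mono) (auto simp: r_def)
  finally show "\<bar>x powi int n * shifted_ptheta q (int n + 1)\<bar> \<le> ptheta_bound q * r ^ n" by (simp add: mult.commute)
  have "\<bar>x powi (- int n) * shifted_ptheta q (- int n + 1)\<bar> \<le> inverse (x ^ n) * (ptheta_bound q * q ^ n)"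
    using x shifted_ptheta_bound_neg[OF q, of n] by (simp add: abs_mult power_int_minus mult_left_mono)
  also have "\<dots> = ptheta_bound q * (q / x) ^ n" by (simp add: power_divide field_simps)
  also have "\<dots> \<le> ptheta_bound q * r ^ n"
    using x q ptheta_bound_nonneg[OF q] by (intro mult_left_mono power_mono) (auto simp: r_def)
  finally show "\<bar>x powi (- int n) * shifted_ptheta q (- int n + 1)\<bar> \<le> ptheta_bound q * r ^ n" .
qed

text \<open>
The coefficient of the double series at \<open>(n, j)\<close> depends on \<open>n - j\<close> and \<open>j\<close> separately, hence the
substitution \<open>m = n - j\<close> separates the two summations.
\<close>

lemma sum_theta_quotient:
  fixes q :: real
  assumes q: "0 < q" "q < 1"
    and "q < x" "x < 1" "z \<noteq> 0"
  shows "(\<Sum>\<^sub>\<infinity>n. x powi n * theta_quotient q n z) = ptheta_series q x * theta q (- (x * z))"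
proof -
  have x: "x \<noteq> 0" using assms q by simp
  define F where "F = (\<lambda>(m, j). (x powi m * shifted_ptheta q (m + 1)) * (q powi tri j * (- (x * z)) powi j))"
  have F: "F summable_on UNIV \<times> UNIV" "infsum F (UNIV \<times> UNIV) = ptheta_series q x * theta q (- (x * z))"
    unfolding F_def ptheta_series_def theta_def
    using infsum_product[OF ptheta_series_summable[OF q assms(3,4)] summable_theta[OF q, of "- (x * z)"]] x assms(5)
    by auto
  have bij: "bij_betw (\<lambda>(n, j). (n - j, j)) (UNIV \<times> UNIV) (UNIV \<times> (UNIV :: int set))"
    by (rule bij_betwI[of _ _ _ "\<lambda>(m, j). (m + j, j)"]) auto
  have e: "F (case nj of (n, j) \<Rightarrow> (n - j, j)) =
      (case nj of (n, j) \<Rightarrow> x powi n * (q powi tri j * (- z) powi j * shifted_ptheta q (n - j + 1)))" for nj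
  proof -
    obtain n j where nj: "nj = (n, j)" by (cases nj)
    have "(- (x * z)) powi j = x powi j * (- z) powi j"
      by (metis mult_minus_right power_int_mult_distrib)
    moreover have "x powi n = x powi (n - j) * x powi j"
      using x by (simp flip: power_int_add)
    ultimately show ?thesis by (simp add: F_def nj mult_ac)
  qed
  have S: "(\<lambda>(n, j). x powi n * (q powi tri j * (- z) powi j * shifted_ptheta q (n - j + 1))) summable_on UNIV \<times> UNIV"
    using summable_on_reindex_bij_betw[OF bij, of F] F(1) unfolding e by simp
  have "(\<Sum>\<^sub>\<infinity>n. x powi n * theta_quotient q n z) =
      (\<Sum>\<^sub>\<infinity>n. \<Sum>\<^sub>\<infinity>j. x powi n * (q powi tri j * (- z) powi j * shifted_ptheta q (n - j + 1)))"
    by (simp add: theta_quotient_def infsum_cmult_right')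
  also have "\<dots> = infsum (\<lambda>(n, j). x powi n * (q powi tri j * (- z) powi j * shifted_ptheta q (n - j + 1))) (UNIV \<times> UNIV)"
    by (rule infsum_Sigma'_banach[OF S])
  also have "\<dots> = infsum F (UNIV \<times> UNIV)"
    using infsum_reindex_bij_betw[OF bij, of F] unfolding e .
  finally show ?thesis using F(2) by simp
qed

lemma powi_eq_1_iff:
  fixes q :: real
  assumes q: "0 < q" "q < 1"
  shows "q powi n = 1 \<longleftrightarrow> n = 0"
proof
  assume 1: "q powi n = 1"
  show "n = 0"
  proof (rule ccontr)
    assume "n \<noteq> 0"
    then have "q powi n < 1 \<or> q powi (- n) < 1"
      using q power_int_strict_decreasing[of 0 n q] power_int_strict_decreasing[of 0 "- n" q] by fastforce
    then show False using 1 by (simp add: power_int_minus)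
  qed
qed simp

text \<open>
At \<open>z = 1\<close> the theta function vanishes, hence so do all quotients except the one whose denominator
vanishes as well.  The right-hand side therefore does not depend on \<open>x\<close>.
\<close>

lemma ptheta_series_times_theta:
  fixes q :: real
  assumes q: "0 < q" "q < 1"
    and "q < x" "x < 1"
  shows "ptheta_series q x * theta q (- x) = theta_quotient q 0 1"
proof -
  have "theta q (- 1) = 0" using theta_quotient[OF q, of 1 0] by simp
  then have zero: "theta_quotient q n 1 = 0" if "n \<noteq> 0" for n
    using theta_quotient[OF q, of 1 n] that powi_eq_1_iff[OF q, of n] by simp
  have "ptheta_series q x * theta q (- x) = (\<Sum>\<^sub>\<infinity>n. x powi n * theta_quotient q n 1)"
    using sum_theta_quotient[OF assms, of 1] by simp
  also have "\<dots> = (\<Sum>\<^sub>\<infinity>n\<in>{0}. x powi n * theta_quotient q n 1)"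
    by (rule infsum_cong_neutral) (auto simp: zero)
  finally show ?thesis by simp
qed

text \<open>
Since \<open>shifted_ptheta m\<close> tends to 1 for large \<open>m\<close>, the series behaves like the geometric series near
\<open>x = 1\<close>; the difference of the two is bounded uniformly by a two-sided geometric series.
\<close>

lemma ptheta_series_near_1:
  fixes q :: real
  assumes q: "0 < q" "q < 1"
  shows "\<exists>K. \<forall>x. (1 + q) / 2 < x \<longrightarrow> x < 1 \<longrightarrow> \<bar>(1 - x) * ptheta_series q x - 1\<bar> \<le> K * (1 - x)"
proof -
  \<comment> \<open>The ratio \<open>s\<close> bounds both \<open>q\<close> and \<open>q / x\<close> for all \<open>x\<close> above the midpoint of \<open>q\<close> and 1.\<close>
  define s where "s = 2 * q / (1 + q)"
  have s: "0 < s" "s < 1" "q \<le> s" using q by (auto simp: s_def field_simps)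
  define g where "g = (\<lambda>m::int. ptheta_bound q * s ^ nat \<bar>m\<bar>)"
  have g: "g summable_on UNIV"
    by (rule summable_on_int_geometric[of s _ "ptheta_bound q"]) (use s ptheta_bound_nonneg[OF q] in \<open>auto simp: g_def\<close>)
  have "\<bar>(1 - x) * ptheta_series q x - 1\<bar> \<le> infsum g UNIV * (1 - x)" if x: "(1 + q) / 2 < x" "x < 1" for x
  proof -
    have qx: "q < x" "0 < x" using x q by auto
    have sx: "q / x \<le> s"
    proof -
      have "q * (1 + q) \<le> 2 * q * x" using x(1) q by (simp add: mult.assoc)
      then show ?thesis using q qx by (simp add: s_def divide_simps mult_ac)
    qed
    define e where "e = (\<lambda>m::int. if 0 \<le> m then x powi m else 0)"
    define u where "u = (\<lambda>m. x powi m * shifted_ptheta q (m + 1) - e m)"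
    have e: "(e has_sum 1 / (1 - x)) UNIV"
    proof -
      have "((\<lambda>m. x powi m) \<circ> int has_sum 1 / (1 - x)) UNIV"
        using geometric_has_sum[of x] x qx by (simp add: o_def)
      then have "((\<lambda>m. x powi m) has_sum 1 / (1 - x)) (range int)"
        by (subst has_sum_reindex) auto
      moreover have "(e has_sum S) UNIV \<longleftrightarrow> ((\<lambda>m. x powi m) has_sum S) (range int)" for S
        by (rule has_sum_cong_neutral) (auto simp: e_def, metis nonneg_int_cases rangeI)
      ultimately show ?thesis by simp
    qed
    have u_le: "\<bar>u m\<bar> \<le> g m" for m
    proof (cases "0 \<le> m")
      case True
      then obtain n where m: "m = int n" using nonneg_int_cases by blast
      have "u m = x ^ n * (shifted_ptheta q (m + 1) - 1)"
        by (simp add: u_def e_def m algebra_simps)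
      also have "shifted_ptheta q (m + 1) - 1 = - (q ^ Suc n * shifted_ptheta q (m + 2))"
        using shifted_ptheta_rec[OF q, of "m + 1"] by (simp add: m powi_add_q[OF q] algebra_simps)
      finally have "u m = - (x ^ n * (q ^ Suc n * shifted_ptheta q (m + 2)))" by simp
      then have "\<bar>u m\<bar> = x ^ n * (q ^ Suc n * \<bar>shifted_ptheta q (m + 2)\<bar>)"
        using q qx by (simp add: abs_mult)
      also have "\<dots> \<le> 1 * (s ^ n * ptheta_bound q)"
      proof (intro mult_mono)
        have "q ^ Suc n \<le> q ^ n" using q by (intro power_decreasing) auto
        also have "\<dots> \<le> s ^ n" using q s by (intro power_mono) auto
        finally show "q ^ Suc n \<le> s ^ n" .
      qed (use x qx q s shifted_ptheta_bound[OF q] ptheta_bound_nonneg[OF q] in \<open>auto intro: power_le_one\<close>)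
      finally show ?thesis by (simp add: g_def m mult.commute)
    next
      case False
      define n where "n = nat (- m)"
      have m: "m = - int n" using False by (simp add: n_def)
      have "\<bar>u m\<bar> = inverse (x ^ n) * \<bar>shifted_ptheta q (1 - int n)\<bar>"
        using False qx by (simp add: u_def e_def m abs_mult power_int_minus)
      also have "\<dots> \<le> inverse (x ^ n) * (ptheta_bound q * q ^ n)"
        using qx shifted_ptheta_bound_neg[OF q, of n] by (intro mult_left_mono) auto
      also have "\<dots> = ptheta_bound q * (q / x) ^ n" by (simp add: power_divide field_simps)
      also have "\<dots> \<le> ptheta_bound q * s ^ n"
        using sx q qx ptheta_bound_nonneg[OF q] by (intro mult_left_mono power_mono) auto
      finally show ?thesis by (simp add: g_def m)
    qed
    have ptheta_series: "((\<lambda>m. x powi m * shifted_ptheta q (m + 1)) has_sum ptheta_series q x) UNIV"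
      unfolding ptheta_series_def using ptheta_series_summable[OF q qx(1) x(2)] by (rule has_sum_infsum)
    have "((\<lambda>m. - e m) has_sum - (1 / (1 - x))) UNIV"
      using e by (simp only: has_sum_uminus minus_minus)
    from has_sum_add[OF ptheta_series this] have u: "(u has_sum ptheta_series q x - 1 / (1 - x)) UNIV"
      by (simp only: u_def diff_conv_add_uminus)
    have "norm (ptheta_series q x - 1 / (1 - x)) \<le> infsum g UNIV"
      by (rule norm_infsum_le[OF u has_sum_infsum[OF g]]) (simp only: real_norm_def u_le)
    then have "\<bar>ptheta_series q x - 1 / (1 - x)\<bar> \<le> infsum g UNIV" by (simp only: real_norm_def)
    then have "\<bar>ptheta_series q x - 1 / (1 - x)\<bar> * \<bar>1 - x\<bar> \<le> infsum g UNIV * (1 - x)"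
      using x by (simp add: mult_right_mono)
    moreover have "(ptheta_series q x - 1 / (1 - x)) * (1 - x) = (1 - x) * ptheta_series q x - 1"
      using x by (simp add: algebra_simps)
    ultimately show ?thesis by (simp only: abs_mult[symmetric])
  qed
  then show ?thesis by blast
qed

text \<open>
The constant of \<open>ptheta_series_times_theta\<close> is found by letting \<open>x\<close> tend to 1: the pole of the partial
theta series there cancels the factor \<open>1 - x\<close> of the triple product.
\<close>

lemma theta_quotient_0_1:
  fixes q :: real
  assumes q: "0 < q" "q < 1"
  shows "theta_quotient q 0 1 = qprod q (- q) ^ 3"
proof -
  obtain K where K: "\<And>x. (1 + q) / 2 < x \<Longrightarrow> x < 1 \<Longrightarrow> \<bar>(1 - x) * ptheta_series q x - 1\<bar> \<le> K * (1 - x)"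
    using ptheta_series_near_1[OF q] by blast
  have near: "eventually (\<lambda>x. x \<in> {(1 + q) / 2<..<1}) (at_left 1)"
    using q by (intro eventually_at_left_real) auto
  have id: "((\<lambda>x::real. x) \<longlongrightarrow> 1) (at_left 1)" by (rule tendsto_ident_at)
  have "((\<lambda>x. (1 - x) * ptheta_series q x - 1) \<longlongrightarrow> 0) (at_left 1)"
  proof (rule Lim_null_comparison)
    show "eventually (\<lambda>x. norm ((1 - x) * ptheta_series q x - 1) \<le> K * (1 - x)) (at_left 1)"
      using near by eventually_elim (use K in auto)
    show "((\<lambda>x. K * (1 - x)) \<longlongrightarrow> 0) (at_left 1)"
      using tendsto_mult[OF tendsto_const tendsto_diff[OF tendsto_const id], of K 1] by simp
  qed
  then have 1: "((\<lambda>x. (1 - x) * ptheta_series q x) \<longlongrightarrow> 1) (at_left 1)"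
    by (simp add: LIM_zero_iff)
  have cont: "((\<lambda>x. qprod q (- f x)) \<longlongrightarrow> qprod q (- q)) (at_left 1)"
    if f: "(f \<longlongrightarrow> q) (at_left 1)" for f
  proof -
    have unit: "eventually (\<lambda>x. 0 < f x) (at_left 1)" "eventually (\<lambda>x. f x < 1) (at_left 1)"
      using order_tendstoD[OF f] q by auto
    have "((\<lambda>x. qprod q (- f x) - qprod q (- q)) \<longlongrightarrow> 0) (at_left 1)"
    proof (rule Lim_null_comparison)
      show "eventually (\<lambda>x. norm (qprod q (- f x) - qprod q (- q)) \<le> \<bar>f x - q\<bar> / (1 - q)) (at_left 1)"
        using unit by eventually_elim (use qprod_lipschitz[OF q] q in auto)
      have "((\<lambda>x. \<bar>f x - q\<bar> / (1 - q)) \<longlongrightarrow> \<bar>q - q\<bar> / (1 - q)) (at_left 1)"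
        using f q by (intro tendsto_intros) auto
      then show "((\<lambda>x. \<bar>f x - q\<bar> / (1 - q)) \<longlongrightarrow> 0) (at_left 1)" by simp
    qed
    then show ?thesis by (simp add: LIM_zero_iff)
  qed
  have 2: "((\<lambda>x. qprod q (- (x * q))) \<longlongrightarrow> qprod q (- q)) (at_left 1)"
    using tendsto_mult[OF id tendsto_const[of q]] by (intro cont) simp
  have 3: "((\<lambda>x. qprod q (- (q / x))) \<longlongrightarrow> qprod q (- q)) (at_left 1)"
    using tendsto_divide[OF tendsto_const[of q] id] by (intro cont) simp
  have "((\<lambda>x. (1 - x) * ptheta_series q x * (qprod q (- q) * qprod q (- (x * q)) * qprod q (- (q / x))))
      \<longlongrightarrow> 1 * (qprod q (- q) * qprod q (- q) * qprod q (- q))) (at_left 1)"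
    by (intro tendsto_mult 1 2 3 tendsto_const)
  moreover have "eventually (\<lambda>x. (1 - x) * ptheta_series q x * (qprod q (- q) * qprod q (- (x * q)) * qprod q (- (q / x)))
      = theta_quotient q 0 1) (at_left 1)"
    using near
  proof eventually_elim
    case (elim x)
    then have x: "q < x" "x < 1" "x \<noteq> 0" using q by auto
    have "theta q (- x) = qprod q (- q) * ((1 - x) * qprod q (- (x * q))) * qprod q (- (q / x))"
      using jacobi_triple_product[OF q, of "- x"] x qprod_shift[OF q, of "- x"] by simp
    then show ?case using ptheta_series_times_theta[OF q x(1,2)] by (simp add: mult_ac)
  qed
  ultimately have "((\<lambda>x. theta_quotient q 0 1) \<longlongrightarrow> qprod q (- q) ^ 3) (at_left (1::real))"
    by (simp add: power3_eq_cube tendsto_cong)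
  then show ?thesis
    by (intro tendsto_unique[OF _ tendsto_const]) (auto simp: trivial_limit_at_left_real)
qed

text \<open>
For the base \<open>q\<^sup>3\<close> and \<open>x = z = q\<close> the quotient \<open>theta_quotient n q\<close> is a constant multiple of
\<open>1 / (1 - q\<^bsup>3n+1\<^esup>)\<close>.  The two theta values that occur agree, because the triple product is invariant
under replacing \<open>y\<close> by \<open>q\<^sup>3 / y\<close>.
\<close>

theorem lambert_series_eq_product:
  assumes q: "0 < q" "q < (1::real)"
  shows "(\<Sum>\<^sub>\<infinity>n. q powi n / (1 - q powi (3 * n + 1))) * qprod q (- q) = qprod (q ^ 3) (- (q ^ 3)) ^ 3"
proof -
  define w where "w = q ^ 3"
  have w: "0 < w" "w < 1" using q by (auto simp: w_def power_less_one_iff)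
  have wq: "w < q" using q power_strict_decreasing[of 1 3 q] by (simp add: w_def)
  have sq: "w / q = q ^ 2" using q by (simp add: w_def power3_eq_cube power2_eq_square)
  have th: "theta w (- q) = qprod q (- q)"
    using jacobi_triple_product[OF w, of "- q"] qprod_triple[OF q, of "- q"] q sq
    by (simp add: w_def power2_eq_square power3_eq_cube mult_ac)
  have th2: "theta w (- (q * q)) = theta w (- q)"
  proof -
    have "w / (q * q) = q" using q by (simp add: w_def power3_eq_cube)
    then show ?thesis
      using jacobi_triple_product[OF w, of "- q"] jacobi_triple_product[OF w, of "- (q * q)"] q sq
      by (simp add: power2_eq_square)
  qed
  have "theta_quotient w n q = qprod q (- q) / (1 - q powi (3 * n + 1))" for n
  proof -
    have e: "q * w powi n = q powi (3 * n + 1)"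
      using q by (simp add: w_def power_int_add power_int_mult)
    have "q powi (3 * n + 1) \<noteq> 1" unfolding powi_eq_1_iff[OF q] by presburger
    then show ?thesis using theta_quotient[OF w, of q n] q th unfolding e by (simp add: field_simps)
  qed
  then have "(\<Sum>\<^sub>\<infinity>n. q powi n * (qprod q (- q) / (1 - q powi (3 * n + 1)))) = ptheta_series w q * theta w (- (q * q))"
    using sum_theta_quotient[OF w wq q(2), of q] q by simp
  also have "\<dots> = qprod w (- w) ^ 3"
    using ptheta_series_times_theta[OF w wq q(2)] theta_quotient_0_1[OF w] th2 by simp
  also have "(\<Sum>\<^sub>\<infinity>n. q powi n * (qprod q (- q) / (1 - q powi (3 * n + 1)))) =
      (\<Sum>\<^sub>\<infinity>n. q powi n / (1 - q powi (3 * n + 1))) * qprod q (- q)"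
    unfolding infsum_cmult_left'[symmetric] by (simp add: mult_ac)
  finally show ?thesis by (simp add: w_def)
qed

section \<open>Coordinates for 3-cores\<close>

text \<open>
The first-column hook lengths of a partition, from top to bottom.
\<close>

fun beta_list :: "nat list \<Rightarrow> nat list" where
  "beta_list [] = []"
| "beta_list (p # l) = (p + length l) # beta_list l"

lemma length_beta_list [simp]: "length (beta_list l) = length l"
  by (induction l) auto

text \<open>
Row \<open>i\<close> has first-column hook length \<open>l ! i\<close> plus the number of rows below it.
\<close>

lemma set_beta_list: "b \<in> set (beta_list l) \<longleftrightarrow> (\<exists>i<length l. b = l ! i + (length l - 1 - i))"
proof (induction l)
  case (Cons p l)
  show ?case
  proof
    assume "b \<in> set (beta_list (p # l))"
    then consider "b = p + length l" | "b \<in> set (beta_list l)" by auto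
    then show "\<exists>i<length (p # l). b = (p # l) ! i + (length (p # l) - 1 - i)"
    proof cases
      case 1
      then show ?thesis by (intro exI[of _ 0]) auto
    next
      case 2
      then obtain i where "i < length l" "b = l ! i + (length l - 1 - i)" using Cons by blast
      then show ?thesis by (intro exI[of _ "Suc i"]) auto
    qed
  next
    assume "\<exists>i<length (p # l). b = (p # l) ! i + (length (p # l) - 1 - i)"
    then obtain i where i: "i < length (p # l)" "b = (p # l) ! i + (length (p # l) - 1 - i)" by blast
    show "b \<in> set (beta_list (p # l))"
    proof (cases i)
      case (Suc k)
      then show ?thesis using i Cons by auto
    qed (use i in auto)
  qed
qed auto

lemma is_partition_Cons:
  "is_partition (p # l) \<longleftrightarrow> 0 < p \<and> (\<forall>x\<in>set l. x \<le> p) \<and> is_partition l"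
  by (auto simp: is_partition_def)

lemma beta_list_less:
  assumes "is_partition (p # l)" "b \<in> set (beta_list l)"
  shows "b < p + length l"
proof -
  obtain i where i: "i < length l" "b = l ! i + (length l - 1 - i)"
    using assms(2) set_beta_list by blast
  moreover have "l ! i \<le> p" using assms(1) i by (simp add: is_partition_Cons)
  ultimately show ?thesis by linarith
qed

lemma beta_list_decreasing:
  "is_partition l \<Longrightarrow> sorted_wrt (>) (beta_list l)"
  by (induction l) (auto simp: beta_list_less is_partition_Cons intro: beta_list_less)

lemma beta_list_pos: "is_partition l \<Longrightarrow> b \<in> set (beta_list l) \<Longrightarrow> 0 < b"
  by (induction l) (auto simp: is_partition_Cons)

lemma sorted_wrt_greater_distinct: "sorted_wrt (>) (l :: nat list) \<Longrightarrow> distinct l"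
  by (induction l) auto

lemma card_beta_list: "is_partition l \<Longrightarrow> card (set (beta_list l)) = length l"
  using beta_list_decreasing distinct_card sorted_wrt_greater_distinct by fastforce

lemma Suc_mem_cells_Cons: "(Suc i, j) \<in> cells (p # l) \<longleftrightarrow> (i, j) \<in> cells l"
  by (simp add: cells_def)

lemma zero_mem_cells_Cons: "(0, j) \<in> cells (p # l) \<longleftrightarrow> j < p"
  by (simp add: cells_def)

text \<open>
The length of column \<open>j\<close>, that is, part \<open>j\<close> of the conjugate partition.
\<close>

definition col_length :: "nat list \<Rightarrow> nat \<Rightarrow> nat" where
  "col_length l j = card {k. k < length l \<and> j < l ! k}"

lemma hook_number_Cons_Suc: "hook_number (p # l) (Suc i) j = hook_number l i j"
proof -
  have "{k. Suc i < k \<and> (k, j) \<in> cells (p # l)} = Suc ` {k. i < k \<and> (k, j) \<in> cells l}"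
  proof (intro equalityI subsetI)
    fix k assume k: "k \<in> {k. Suc i < k \<and> (k, j) \<in> cells (p # l)}"
    then obtain m where "k = Suc m" by (cases k) auto
    then show "k \<in> Suc ` {k. i < k \<and> (k, j) \<in> cells l}"
      using k by (simp add: Suc_mem_cells_Cons)
  qed (auto simp: Suc_mem_cells_Cons)
  then show ?thesis
    by (simp add: hook_number_def arm_def leg_def Suc_mem_cells_Cons card_image)
qed

lemma hook_number_Cons_0:
  assumes "j < p"
  shows "hook_number (p # l) 0 j = p - j + col_length l j"
proof -
  have "{k. 0 < k \<and> (k, j) \<in> cells (p # l)} = Suc ` {k. k < length l \<and> j < l ! k}"
  proof (intro equalityI subsetI)
    fix k assume k: "k \<in> {k. 0 < k \<and> (k, j) \<in> cells (p # l)}"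
    then obtain m where "k = Suc m" by (cases k) auto
    then show "k \<in> Suc ` {k. k < length l \<and> j < l ! k}"
      using k by (simp add: cells_def)
  qed (auto simp: cells_def)
  moreover have "{k. j < k \<and> (0, k) \<in> cells (p # l)} = {j<..<p}"
    by (auto simp: zero_mem_cells_Cons)
  ultimately show ?thesis using assms
    by (simp add: hook_number_def arm_def leg_def col_length_def card_image)
qed

lemma forall_nat_split_Suc: "(\<forall>i::nat. P i) \<longleftrightarrow> P 0 \<and> (\<forall>i. P (Suc i))"
  by (metis not0_implies_Suc)

lemma is_core_Cons:
  "is_core t (p # l) \<longleftrightarrow>
     is_partition (p # l) \<and> is_core t l \<and> (\<forall>j<p. \<not> t dvd p - j + col_length l j)"
proof -
  have "(\<forall>(i, j)\<in>cells (p # l). \<not> t dvd hook_number (p # l) i j) \<longleftrightarrow>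
      (\<forall>j. (0, j) \<in> cells (p # l) \<longrightarrow> \<not> t dvd hook_number (p # l) 0 j) \<and>
      (\<forall>i j. (Suc i, j) \<in> cells (p # l) \<longrightarrow> \<not> t dvd hook_number (p # l) (Suc i) j)"
    using forall_nat_split_Suc[of "\<lambda>i. \<forall>j. (i, j) \<in> cells (p # l) \<longrightarrow> \<not> t dvd hook_number (p # l) i j"]
    by (simp add: Ball_def split_paired_All)
  also have "\<dots> \<longleftrightarrow> (\<forall>j<p. \<not> t dvd p - j + col_length l j) \<and>
       (\<forall>(i, j)\<in>cells l. \<not> t dvd hook_number l i j)"
    by (auto simp: zero_mem_cells_Cons Suc_mem_cells_Cons hook_number_Cons_Suc hook_number_Cons_0)
  finally show ?thesis
    by (auto simp: is_core_def is_partition_Cons)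
qed

text \<open>
Walking along the boundary of the diagram of \<open>l\<close> inside a box of width \<open>p\<close>, each step is either
vertical and belongs to a row or horizontal and belongs to a column.  The beta numbers are the
positions of the vertical steps and the left-hand side lists those of the horizontal ones, so
together they exhaust all \<open>p + length l\<close> positions.
\<close>

lemma first_row_complement:
  assumes "is_partition (p # l)"
  shows "(\<lambda>j. j + length l - col_length l j) ` {..<p} = {..<p + length l} - set (beta_list l)"
    (is "?v ` _ = _")
proof -
  let ?S = "\<lambda>j. {k. k < length l \<and> j < l ! k}"
  have le: "col_length l j \<le> length l" for j
    using card_mono[of "{..<length l}" "?S j"] by (auto simp: col_length_def)
  \<comment> \<open>Both sides have \<open>p\<close> elements, so it suffices that the positions given by the columns are
    distinct and are not beta numbers.\<close>
  have anti: "col_length l j' \<le> col_length l j" if "j \<le> j'" for j j'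
    unfolding col_length_def using that by (intro card_mono) auto
  have part: "is_partition l" using assms by (simp add: is_partition_Cons)
  have mono: "l ! k \<ge> l ! i" if "k \<le> i" "i < length l" for k i
    using part that sorted_wrt_nth_less[of "(\<ge>)" l k i]
    by (cases "k = i") (auto simp: is_partition_def)
  have "strict_mono_on {..<p} ?v"
  proof (rule strict_mono_onI)
    fix r s :: nat assume "r < s"
    then show "?v r < ?v s" using le[of r] le[of s] anti[of r s] by linarith
  qed
  then have inj: "inj_on ?v {..<p}" by (rule strict_mono_on_imp_inj_on)
  have disj: "?v j \<notin> set (beta_list l)" for j
  proof
    assume "?v j \<in> set (beta_list l)"
    then obtain i where i: "i < length l" "?v j = l ! i + (length l - 1 - i)"
      using set_beta_list by blast
    show False
    proof (cases "j < l ! i")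
      case True
      have "k \<in> ?S j" if "k \<le> i" for k
        using mono[OF that i(1)] True that i(1) by simp
      then have "{..i} \<subseteq> ?S j" by blast
      then have "card {..i} \<le> card (?S j)" by (intro card_mono) auto
      then have "i + 1 \<le> col_length l j" by (simp add: col_length_def)
      then show False using i True le[of j] by linarith
    next
      case False
      have "k < i" if "k \<in> ?S j" for k
        using mono[of i k] False that by (cases "k < i") auto
      then have "?S j \<subseteq> {..<i}" by blast
      then have "card (?S j) \<le> card {..<i}" by (intro card_mono) auto
      then have "col_length l j \<le> i" by (simp add: col_length_def)
      then show False using i False by linarith
    qed
  qed
  have sub: "set (beta_list l) \<subseteq> {..<p + length l}"
    using beta_list_less[OF assms] by auto
  show ?thesis
  proof (rule card_subset_eq)
    show "?v ` {..<p} \<subseteq> {..<p + length l} - set (beta_list l)"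
      using disj le by auto
    show "card (?v ` {..<p}) = card ({..<p + length l} - set (beta_list l))"
      using card_image[OF inj] sub card_beta_list[OF part] by (simp add: card_Diff_subset)
  qed simp
qed

text \<open>
A hook length of the first row is the distance from the first beta number \<open>p + length l\<close> down to a
position that is not a beta number.
\<close>

lemma first_row_hooks:
  assumes "is_partition (p # l)"
  shows "(\<forall>j<p. \<not> t dvd p - j + col_length l j) \<longleftrightarrow>
         (\<forall>b<p + length l. b \<notin> set (beta_list l) \<longrightarrow> \<not> t dvd p + length l - b)"
proof -
  have le: "col_length l j \<le> length l" for j
    using card_mono[of "{..<length l}" "{k. k < length l \<and> j < l ! k}"]
    by (auto simp: col_length_def)
  have "(\<forall>b<p + length l. b \<notin> set (beta_list l) \<longrightarrow> \<not> t dvd p + length l - b) \<longleftrightarrow>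
        (\<forall>b\<in>{..<p + length l} - set (beta_list l). \<not> t dvd p + length l - b)"
    by blast
  also have "\<dots> \<longleftrightarrow> (\<forall>j<p. \<not> t dvd p + length l - (j + length l - col_length l j))"
    unfolding first_row_complement[OF assms, symmetric] by auto
  also have "\<dots> \<longleftrightarrow> (\<forall>j<p. \<not> t dvd p - j + col_length l j)"
  proof -
    have "p + length l - (j + length l - col_length l j) = p - j + col_length l j" if "j < p" for j
      using that le[of j] by linarith
    then show ?thesis by simp
  qed
  finally show ?thesis by blast
qed

text \<open>
By \<open>first_row_hooks\<close>, the hooks of the first row avoid all multiples of \<open>t\<close> iff every position reached
from the first beta number by subtracting multiples of \<open>t\<close> is a beta number.  As the beta numbers of
the remaining rows are already closed under subtracting \<open>t\<close>, the first step suffices.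
\<close>

lemma is_core_iff_beta_closed:
  assumes "0 < t"
  shows "is_core t l \<longleftrightarrow>
    is_partition l \<and> (\<forall>b\<in>set (beta_list l). t \<le> b \<longrightarrow> b - t \<in> set (beta_list l))"
proof (induction l)
  case Nil
  then show ?case by (auto simp: is_core_def cells_def)
next
  case (Cons p l)
  show ?case
  proof (cases "is_partition (p # l)")
    case False
    then show ?thesis by (simp add: is_core_def)
  next
    case part: True
    let ?B = "set (beta_list l)" and ?h = "p + length l"
    have lt: "b < ?h" if "b \<in> ?B" for b using beta_list_less[OF part that] .
    have row: "(\<forall>b<?h. b \<notin> ?B \<longrightarrow> \<not> t dvd ?h - b) \<longleftrightarrow> (t \<le> ?h \<longrightarrow> ?h - t \<in> ?B)"
      if closed: "\<forall>b\<in>?B. t \<le> b \<longrightarrow> b - t \<in> ?B"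
    proof (intro iffI allI impI notI)
      assume H: "\<forall>b<?h. b \<notin> ?B \<longrightarrow> \<not> t dvd ?h - b" and "t \<le> ?h"
      moreover have "?h - (?h - t) = t" "?h - t < ?h" using \<open>t \<le> ?h\<close> assms by linarith+
      ultimately show "?h - t \<in> ?B" using assms H[rule_format, of "?h - t"]
        by (cases "?h - t \<in> ?B") auto
    next
      fix b assume H: "t \<le> ?h \<longrightarrow> ?h - t \<in> ?B" and b: "b < ?h" "b \<notin> ?B" "t dvd ?h - b"
      \<comment> \<open>From the second step on, the closure of the beta numbers of the remaining rows applies.\<close>
      have steps: "?h - Suc k * t \<in> ?B" if "Suc k * t \<le> ?h" for k
        using that
      proof (induction k)
        case (Suc k)
        then have "?h - Suc k * t \<in> ?B" by simp
        moreover have "t \<le> ?h - Suc k * t" using Suc.prems by simp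
        ultimately have "?h - Suc k * t - t \<in> ?B" using closed by blast
        moreover have "?h - Suc k * t - t = ?h - Suc (Suc k) * t" by simp
        ultimately show ?case by metis
      qed (use H in simp)
      obtain c where c: "?h - b = t * c" using b(3) by blast
      then obtain k where "c = Suc k" using b(1) by (cases c) auto
      then have "?h - b = Suc k * t" using c by (simp add: mult.commute)
      then have "b = ?h - Suc k * t" "Suc k * t \<le> ?h" using b(1) by linarith+
      then show False using steps[of k] b(2) by metis
    qed
    have IH: "is_core t l \<longleftrightarrow> (\<forall>b\<in>?B. t \<le> b \<longrightarrow> b - t \<in> ?B)"
      using Cons.IH part by (simp add: is_partition_Cons)
    have "is_core t (p # l) \<longleftrightarrow>
        is_core t l \<and> (\<forall>b<?h. b \<notin> ?B \<longrightarrow> \<not> t dvd ?h - b)"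
      using part first_row_hooks[OF part, of t] is_core_Cons[of t p l] by argo
    also have "\<dots> \<longleftrightarrow> (\<forall>b\<in>?B. t \<le> b \<longrightarrow> b - t \<in> ?B) \<and> (t \<le> ?h \<longrightarrow> ?h - t \<in> ?B)"
      unfolding IH using row by argo
    also have "\<dots> \<longleftrightarrow> (\<forall>b\<in>insert ?h ?B. t \<le> b \<longrightarrow> b - t \<in> insert ?h ?B)"
    proof -
      have "b - t \<in> insert ?h ?B \<longleftrightarrow> b - t \<in> ?B" if "b \<in> insert ?h ?B" "t \<le> b" for b
      proof -
        have "b \<le> ?h" using that(1) lt by (auto intro: less_imp_le)
        then have "b - t \<noteq> ?h" using assms that(2) by linarith
        then show ?thesis by simp
      qed
      then have "(\<forall>b\<in>insert ?h ?B. t \<le> b \<longrightarrow> b - t \<in> insert ?h ?B) \<longleftrightarrow>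
          (\<forall>b\<in>insert ?h ?B. t \<le> b \<longrightarrow> b - t \<in> ?B)"
        by metis
      then show ?thesis by (simp only: ball_simps(7)) argo
    qed
    finally show ?thesis using part by simp
  qed
qed

lemma ex_partition_beta:
  assumes "finite B" "0 \<notin> B"
  shows "\<exists>l. is_partition l \<and> set (beta_list l) = B"
  using assms
proof (induction B rule: finite_linorder_max_induct)
  case empty
  then show ?case by (intro exI[of _ "[]"]) (simp add: is_partition_def)
next
  case (insert m A)
  then obtain l where l: "is_partition l" "set (beta_list l) = A"
    using insert.IH insert.prems by blast
  have gap: "x + length l \<le> m" if x: "x \<in> set l" for x
  proof -
    obtain i where i: "i < length l" "x = l ! i" using x by (metis in_set_conv_nth)
    have "l ! i \<le> l ! 0"
      using l(1) i(1) sorted_wrt_nth_less[of "(\<ge>)" l 0 i]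
      by (cases i) (auto simp: is_partition_def)
    moreover have "l ! 0 + (length l - 1) < m"
    proof -
      have "l ! 0 + (length l - 1) \<in> set (beta_list l)"
        unfolding set_beta_list using i(1) by (intro exI[of _ 0]) auto
      then show ?thesis using insert.hyps(2) l(2) by blast
    qed
    ultimately show ?thesis using i by linarith
  qed
  have pos: "0 < m - length l"
  proof (cases l)
    case Nil
    then show ?thesis using insert.prems by simp
  next
    case (Cons x xs)
    then have "0 < x" using l(1) by (simp add: is_partition_Cons)
    then show ?thesis using gap[of x] Cons by simp
  qed
  have "x \<le> m - length l" if "x \<in> set l" for x using gap[OF that] by linarith
  then have "is_partition ((m - length l) # l)"
    using pos l(1) by (simp add: is_partition_Cons)
  moreover have "set (beta_list ((m - length l) # l)) = insert m A"
    using pos l(2) by simp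
  ultimately show ?case by blast
qed

lemma beta_list_inject: "length l = length l' \<Longrightarrow> beta_list l = beta_list l' \<Longrightarrow> l = l'"
  by (induction l l' rule: list_induct2) auto

lemma partition_eqI:
  assumes "is_partition l" "is_partition l'" "set (beta_list l) = set (beta_list l')"
  shows "l = l'"
proof -
  have "rev (beta_list l) = sorted_list_of_set (set (beta_list l))" if "is_partition l" for l
    using beta_list_decreasing[OF that] sorted_wrt_greater_distinct
    by (intro sorted_distinct_set_unique) (auto simp: sorted_wrt_rev intro: sorted_wrt_mono_rel[rotated])
  then have "beta_list l = beta_list l'"
    using assms by (metis rev_rev_ident)
  then show ?thesis using beta_list_inject by (metis length_beta_list)
qed

lemma sum_beta_list: "is_partition l \<Longrightarrow> 2 * \<Sum>(set (beta_list l)) + length l = 2 * sum_list l + length l * length l"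
proof (induction l)
  case (Cons p l)
  have "p + length l \<notin> set (beta_list l)" using beta_list_less[OF Cons.prems] by blast
  then show ?case using Cons by (simp add: is_partition_Cons algebra_simps)
qed simp

text \<open>
The beta sets of 3-cores: \<open>a\<close> beads on the runner of residue 1 and \<open>b\<close> beads on the runner of residue 2.
There are none on the runner of residue 0, because beta numbers are positive.
\<close>

definition core3_beta :: "nat \<Rightarrow> nat \<Rightarrow> nat set" where
  "core3_beta a b = (\<lambda>i. 3 * i + 1) ` {..<a} \<union> (\<lambda>i. 3 * i + 2) ` {..<b}"

lemma downward_closed_eq_lessThan:
  assumes "finite (S :: nat set)" "\<And>i. Suc i \<in> S \<Longrightarrow> i \<in> S"
  shows "S = {..<card S}"
proof -
  have down: "i \<in> S" if "i \<le> j" "j \<in> S" for i j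
    using that by (induction rule: inc_induct) (auto intro: assms(2))
  have "\<exists>n. S = {..<n}"
  proof (cases "S = {}")
    case False
    then have "S = {..<Suc (Max S)}"
      using down[OF _ Max_in[OF assms(1) False]] Max_ge[OF assms(1)] by (auto simp: less_Suc_eq_le)
    then show ?thesis by blast
  qed auto
  then show ?thesis by force
qed

lemma closed3_eq_core3_beta:
  assumes "finite B" "0 \<notin> B" and closed: "\<forall>b\<in>B. 3 \<le> b \<longrightarrow> b - 3 \<in> B"
  shows "B = core3_beta (card {i. 3 * i + 1 \<in> B}) (card {i. 3 * i + 2 \<in> B})"
proof -
  have fin: "finite {i. 3 * i + r \<in> B}" for r
    using assms(1) finite_vimageI[of B "\<lambda>i. 3 * i + r"] by (simp add: vimage_def inj_def)
  have lt: "{i. 3 * i + r \<in> B} = {..<card {i. 3 * i + r \<in> B}}" for r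
  proof (rule downward_closed_eq_lessThan[OF fin])
    fix i assume "Suc i \<in> {i. 3 * i + r \<in> B}"
    then show "i \<in> {i. 3 * i + r \<in> B}" using closed by force
  qed
  have no0: "3 * i \<notin> B" for i
  proof (induction i)
    case (Suc i)
    then show ?case using closed by force
  qed (use assms(2) in simp)
  have "x \<in> B \<longleftrightarrow> x \<in> (\<lambda>i. 3 * i + 1) ` {i. 3 * i + 1 \<in> B} \<union> (\<lambda>i. 3 * i + 2) ` {i. 3 * i + 2 \<in> B}" for x
  proof -
    have "x = 3 * (x div 3) \<or> x = 3 * (x div 3) + 1 \<or> x = 3 * (x div 3) + 2" by linarith
    then show ?thesis using no0[of "x div 3"] by auto
  qed
  then show ?thesis
    unfolding core3_beta_def lt[of 1, symmetric] lt[of 2, symmetric] by blast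
qed

lemma
  shows finite_core3_beta: "finite (core3_beta a b)" and zero_notin_core3_beta: "0 \<notin> core3_beta a b"
    and core3_beta_closed: "\<forall>x\<in>core3_beta a b. 3 \<le> x \<longrightarrow> x - 3 \<in> core3_beta a b"
    and card_core3_beta: "card (core3_beta a b) = a + b"
    and sum_core3_beta: "2 * \<Sum>(core3_beta a b) + a = 3 * a * a + 3 * b * b + b"
    and runner1_core3_beta: "card {i. 3 * i + 1 \<in> core3_beta a b} = a"
    and runner2_core3_beta: "card {i. 3 * i + 2 \<in> core3_beta a b} = b"
proof -
  show fin: "finite (core3_beta a b)" "0 \<notin> core3_beta a b" by (auto simp: core3_beta_def)
  show "\<forall>x\<in>core3_beta a b. 3 \<le> x \<longrightarrow> x - 3 \<in> core3_beta a b"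
  proof (intro ballI impI)
    fix x assume "x \<in> core3_beta a b" "3 \<le> x"
    then consider i where "i < a" "x = 3 * i + 1" | i where "i < b" "x = 3 * i + 2"
      by (auto simp: core3_beta_def)
    then show "x - 3 \<in> core3_beta a b"
    proof cases
      case 1
      then obtain k where "i = Suc k" using \<open>3 \<le> x\<close> by (cases i) auto
      then show ?thesis using 1 by (auto simp: core3_beta_def)
    next
      case 2
      then obtain k where "i = Suc k" using \<open>3 \<le> x\<close> by (cases i) auto
      then show ?thesis using 2 by (auto simp: core3_beta_def)
    qed
  qed
  have disj: "(\<lambda>i. 3 * i + 1) ` {..<a} \<inter> (\<lambda>i. 3 * i + 2) ` {..<b} = {}" for a b :: nat
    by (auto, presburger)
  show "card (core3_beta a b) = a + b"
    unfolding core3_beta_def using disj by (subst card_Un_disjoint) (auto simp: card_image inj_on_def)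
  \<comment> \<open>The term \<open>3 n\<close> is on the left because subtraction is truncated.\<close>
  have s: "2 * (\<Sum>i<n. 3 * i + r) + 3 * n = 3 * n * n + 2 * r * n" for n r :: nat
    by (induction n) (auto simp: algebra_simps)
  have "\<Sum>(core3_beta a b) = (\<Sum>i<a. 3 * i + 1) + (\<Sum>i<b. 3 * i + 2)"
    unfolding core3_beta_def using disj
    by (subst sum.union_disjoint) (auto simp: sum.reindex inj_on_def)
  then show "2 * \<Sum>(core3_beta a b) + a = 3 * a * a + 3 * b * b + b"
    using s[where n = a and r = 1] s[where n = b and r = 2] by simp
  have ne: "3 * i + 1 \<noteq> 3 * x + (2::nat)" for i x by presburger
  have m1: "3 * i + 1 \<in> core3_beta a b \<longleftrightarrow> i < a" for i
    using ne by (simp only: core3_beta_def Un_iff image_iff) auto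
  have m2: "3 * i + 2 \<in> core3_beta a b \<longleftrightarrow> i < b" for i
    using ne[symmetric] by (simp only: core3_beta_def Un_iff image_iff) auto
  show "card {i. 3 * i + 1 \<in> core3_beta a b} = a" "card {i. 3 * i + 2 \<in> core3_beta a b} = b"
    unfolding m1 m2 by auto
qed

text \<open>
The size of the 3-core with beta set \<open>core3_beta a b\<close>; see \<open>sum_list_core3\<close>.
\<close>

definition core3_energy :: "nat \<times> nat \<Rightarrow> int" where
  "core3_energy = (\<lambda>(a, b). int a ^ 2 - int a * int b + int b ^ 2 + int b)"

definition core3_coords :: "nat list \<Rightarrow> nat \<times> nat" where
  "core3_coords l =
     (card {i. 3 * i + 1 \<in> set (beta_list l)}, card {i. 3 * i + 2 \<in> set (beta_list l)})"

lemma core3_beta_coords: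
  assumes "is_core 3 l" "core3_coords l = (a, b)"
  shows "set (beta_list l) = core3_beta a b"
proof -
  have part: "is_partition l"
    and closed: "\<forall>b\<in>set (beta_list l). 3 \<le> b \<longrightarrow> b - 3 \<in> set (beta_list l)"
    using assms(1) is_core_iff_beta_closed[of 3 l] by simp_all
  have "0 \<notin> set (beta_list l)" using beta_list_pos[OF part] by blast
  from closed3_eq_core3_beta[OF _ this closed] show ?thesis
    using assms(2) by (simp only: core3_coords_def prod.inject) simp
qed

lemma bij_betw_core3_coords: "bij_betw core3_coords {l. is_core 3 l} UNIV"
proof (rule bij_betwI')
  fix l l' assume cores: "l \<in> {l. is_core 3 l}" "l' \<in> {l. is_core 3 l}"
  have "l = l'" if eq: "core3_coords l = core3_coords l'"
  proof -
    obtain a b where ab: "core3_coords l = (a, b)" by (cases "core3_coords l")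
    have "set (beta_list l) = set (beta_list l')"
      using core3_beta_coords[of l a b] core3_beta_coords[of l' a b] cores ab eq by simp
    then show ?thesis using partition_eqI cores by (simp add: is_core_def)
  qed
  then show "core3_coords l = core3_coords l' \<longleftrightarrow> l = l'" by blast
next
  fix ab :: "nat \<times> nat" assume "ab \<in> UNIV"
  obtain a b where ab: "ab = (a, b)" by (cases ab)
  obtain l where l: "is_partition l" "set (beta_list l) = core3_beta a b"
    using ex_partition_beta[of "core3_beta a b"] finite_core3_beta zero_notin_core3_beta by blast
  then have "is_core 3 l"
    using is_core_iff_beta_closed[of 3 l] core3_beta_closed[of a b] by simp
  moreover have "core3_coords l = ab"
    unfolding core3_coords_def l(2) ab using runner1_core3_beta[of a b] runner2_core3_beta[of a b] by simp
  ultimately show "\<exists>l\<in>{l. is_core 3 l}. ab = core3_coords l" by blast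
qed (rule UNIV_I)

lemma sum_list_core3:
  assumes "is_core 3 l"
  shows "int (sum_list l) = core3_energy (core3_coords l)"
proof -
  obtain a b where ab: "core3_coords l = (a, b)" by (cases "core3_coords l")
  note B = core3_beta_coords[OF assms ab]
  have part: "is_partition l" using assms by (simp add: is_core_def)
  have "length l = a + b" using card_beta_list[OF part] card_core3_beta B by simp
  then have "2 * \<Sum>(core3_beta a b) + (a + b) = 2 * sum_list l + (a + b) * (a + b)"
    using sum_beta_list[OF part] B by simp
  with sum_core3_beta[of a b] have "3 * a * a + 3 * b * b + b + b = 2 * sum_list l + (a + b) * (a + b)"
    by linarith
  then have "int (3 * a * a + 3 * b * b + b + b) = int (2 * sum_list l + (a + b) * (a + b))" by (simp only:)
  then have "int (sum_list l) = int a ^ 2 - int a * int b + int b ^ 2 + int b"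
    by (simp add: power2_eq_square algebra_simps)
  then show ?thesis using ab by (simp only: core3_energy_def prod.case)
qed

section \<open>The generating function of 3-cores\<close>

text \<open>
The energy of three stacks of beads of heights \<open>x\<close>, \<open>y\<close>, \<open>z\<close> on the runners of residues 0, 1, 2.
\<close>

definition charge_energy :: "int \<times> int \<times> int \<Rightarrow> int" where
  "charge_energy = (\<lambda>(x, y, z). 3 * tri x + (3 * tri y + y) + (3 * tri z + 2 * z))"

text \<open>
Beads are now placed on all integers.  The core with coordinates \<open>(a, b)\<close> has the runner heights
\<open>(0, a, b)\<close>, and \<open>s\<close> is the number of places by which all beads are shifted upwards.  One shift moves
the heights \<open>(x, y, z)\<close> to \<open>(z + 1, x, y)\<close>, and three shifts add 1 to each height.
\<close>

definition rotate_core :: "(nat \<times> nat) \<times> int \<Rightarrow> int \<times> int \<times> int" where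
  "rotate_core = (\<lambda>((a, b), s). let m = s div 3 in
     if s mod 3 = 0 then (m, int a + m, int b + m)
     else if s mod 3 = 1 then (int b + 1 + m, m, int a + m)
     else (int a + 1 + m, int b + 1 + m, m))"

text \<open>
The position of the lowest gap among the three runners is the amount of the shift.
\<close>

definition unrotate_core :: "int \<times> int \<times> int \<Rightarrow> (nat \<times> nat) \<times> int" where
  "unrotate_core = (\<lambda>(x, y, z).
     if x \<le> y \<and> x \<le> z then ((nat (y - x), nat (z - x)), 3 * x)
     else if y < x \<and> y \<le> z then ((nat (z - y), nat (x - 1 - y)), 3 * y + 1)
     else ((nat (x - 1 - z), nat (y - 1 - z)), 3 * z + 2))"

lemma rotate_core_simps:
  "rotate_core ((a, b), 3 * m) = (m, int a + m, int b + m)"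
  "rotate_core ((a, b), 3 * m + 1) = (int b + 1 + m, m, int a + m)"
  "rotate_core ((a, b), 3 * m + 2) = (int a + 1 + m, int b + 1 + m, m)"
proof -
  have "(3 * m + 1) mod 3 = 1" "(3 * m + 1) div 3 = m" "(3 * m + 2) mod 3 = 2" "(3 * m + 2) div 3 = m"
    by simp_all
  then show "rotate_core ((a, b), 3 * m) = (m, int a + m, int b + m)"
    "rotate_core ((a, b), 3 * m + 1) = (int b + 1 + m, m, int a + m)"
    "rotate_core ((a, b), 3 * m + 2) = (int a + 1 + m, int b + 1 + m, m)"
    by (simp_all add: rotate_core_def Let_def)
qed

lemma int_mod3_cases:
  obtains m where "s = 3 * m" | m where "s = 3 * m + 1" | m where "s = 3 * m + (2::int)"
proof -
  have "s = 3 * (s div 3) \<or> s = 3 * (s div 3) + 1 \<or> s = 3 * (s div 3) + 2" by presburger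
  then show ?thesis using that by blast
qed

lemma bij_rotate_core: "bij_betw rotate_core (UNIV \<times> UNIV) UNIV"
proof (rule bij_betwI)
  show "unrotate_core (rotate_core x) = x" for x
  proof -
    obtain a b s where x: "x = ((a, b), s)" by (metis surj_pair)
    show ?thesis unfolding x
      by (cases s rule: int_mod3_cases) (simp_all add: rotate_core_simps unrotate_core_def)
  qed
  show "rotate_core (unrotate_core v) = v" for v
  proof -
    obtain x y z where v: "v = (x, y, z)" by (metis surj_pair)
    show ?thesis unfolding v
      by (auto simp: rotate_core_simps unrotate_core_def)
  qed
qed auto

text \<open>
Shifting all beads by one place raises the energy by the total charge.  After \<open>s\<close> shifts of a core of
charge \<open>a + b\<close> the accumulated gain depends, up to the size of the core, only on the charge
\<open>a + b + s\<close> that has been reached.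
\<close>

lemma charge_energy_rotate_core:
  "charge_energy (rotate_core ((a, b), s)) = core3_energy (a, b) + tri (int a + int b + s)"
proof -
  have *: "2 * charge_energy (x, y, z) = 3 * (x * (x - 1)) + (3 * (y * (y - 1)) + 2 * y) + (3 * (z * (z - 1)) + 4 * z)"
    for x y z
    unfolding two_tri[symmetric] by (simp add: charge_energy_def)
  have "2 * charge_energy (rotate_core ((a, b), s)) = 2 * (core3_energy (a, b) + tri (int a + int b + s))"
    unfolding distrib_left two_tri core3_energy_def prod.case
    by (cases s rule: int_mod3_cases)
       (simp_all only: rotate_core_simps *, simp_all add: algebra_simps power2_eq_square)
  then show ?thesis by simp
qed

lemma three_thetas:
  fixes q :: real
  assumes q: "0 < q" "q < 1"
  defines "w \<equiv> q ^ 3"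
  shows "(\<lambda>v. q powi charge_energy v) summable_on UNIV"
    and "infsum (\<lambda>v. q powi charge_energy v) UNIV = theta w 1 * (theta w q * theta w (q ^ 2))"
proof -
  have w: "0 < w" "w < 1" using q by (auto simp: w_def power_less_one_iff)
  have s: "(\<lambda>k. w powi tri k * (q ^ i) powi k) summable_on UNIV" for i
    using q by (intro summable_theta[OF w]) auto
  note p2 = infsum_product[OF s[of 1] s[of 2]]
  note p3 = infsum_product[OF s[of 0] p2(1)]
  have e: "(case v of (x, yz) \<Rightarrow> w powi tri x * (q ^ 0) powi x *
      (case yz of (y, z) \<Rightarrow> w powi tri y * (q ^ 1) powi y * (w powi tri z * (q ^ 2) powi z))) =
      q powi charge_energy v" for v
  proof -
    obtain x y z where v: "v = (x, y, z)" by (metis surj_pair)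
    have "w powi tri k = q powi (3 * tri k)" for k by (simp add: w_def power_int_power)
    moreover have "(q ^ 2) powi z = q powi (2 * z)" by (simp add: power_int_power)
    ultimately show ?thesis
      using q by (simp add: v charge_energy_def power_int_add)
  qed
  show "(\<lambda>v. q powi charge_energy v) summable_on UNIV"
    using p3(1) unfolding e by simp
  show "infsum (\<lambda>v. q powi charge_energy v) UNIV = theta w 1 * (theta w q * theta w (q ^ 2))"
    using p3(2) p2(2) unfolding e by (simp add: theta_def)
qed

lemma theta_shift:
  fixes q :: real
  assumes q: "0 < q" "q < 1"
  shows "(\<Sum>\<^sub>\<infinity>s. q powi tri (c + s)) = theta q 1"
proof -
  have "bij_betw (\<lambda>s. c + s) UNIV (UNIV :: int set)"
    by (rule bij_betwI[of _ _ _ "\<lambda>s. s - c"]) auto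
  from infsum_reindex_bij_betw[OF this, of "\<lambda>k. q powi tri k"] show ?thesis
    by (simp add: theta_def)
qed

text \<open>
For each core, summing over all shifts gives a complete theta series in \<open>q\<close>; summing over all runner
heights instead gives three independent theta series in \<open>q\<^sup>3\<close>.
\<close>

lemma core3_sum_times_theta:
  fixes q :: real
  assumes q: "0 < q" "q < 1"
  defines "w \<equiv> q ^ 3"
  shows "(\<lambda>ab. q powi core3_energy ab) summable_on UNIV"
    and "infsum (\<lambda>ab. q powi core3_energy ab) UNIV * theta q 1 =
      theta w 1 * (theta w q * theta w (q ^ 2))"
proof -
  have e: "q powi charge_energy (rotate_core p) =
      (case p of (ab, s) \<Rightarrow> q powi core3_energy ab * q powi tri (int (fst ab) + int (snd ab) + s))" for p
    using q charge_energy_rotate_core[of "fst (fst p)" "snd (fst p)" "snd p"]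
    by (simp add: power_int_add case_prod_unfold)
  have S: "(\<lambda>(ab, s). q powi core3_energy ab * q powi tri (int (fst ab) + int (snd ab) + s))
      summable_on UNIV \<times> UNIV"
    using summable_on_reindex_bij_betw[OF bij_rotate_core, of "\<lambda>v. q powi charge_energy v"]
      three_thetas(1)[OF q] unfolding e by simp
  have I: "infsum (\<lambda>(ab, s). q powi core3_energy ab * q powi tri (int (fst ab) + int (snd ab) + s))
      (UNIV \<times> UNIV) = theta w 1 * (theta w q * theta w (q ^ 2))"
    using infsum_reindex_bij_betw[OF bij_rotate_core, of "\<lambda>v. q powi charge_energy v"]
      three_thetas(2)[OF q] unfolding e by (simp add: w_def)
  have inner: "(\<Sum>\<^sub>\<infinity>s. q powi core3_energy ab * q powi tri (int (fst ab) + int (snd ab) + s)) =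
      q powi core3_energy ab * theta q 1" for ab
    unfolding infsum_cmult_right' theta_shift[OF q] ..
  \<comment> \<open>Needed for transferring summability from the multiple of the series to the series itself.\<close>
  have th: "theta q 1 \<noteq> 0"
    using qprod_pos[OF q, of "- q"] qprod_pos[OF q, of 1] qprod_pos[OF q, of q] q
    by (simp add: jacobi_triple_product[OF q])
  show "(\<lambda>ab. q powi core3_energy ab) summable_on UNIV"
    using summable_on_Sigma_banach[OF S] th unfolding inner by (simp add: summable_on_cmult_left')
  show "infsum (\<lambda>ab. q powi core3_energy ab) UNIV * theta q 1 =
      theta w 1 * (theta w q * theta w (q ^ 2))"
    using infsum_Sigma'_banach[OF S] unfolding inner I infsum_cmult_left' .
qed

text \<open>
By the triple product all theta functions become products.  The three progressions modulo 3 make up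
all exponents, so everything except powers of Euler's products cancels.
\<close>

theorem core3_sum_eq_product:
  fixes q :: real
  assumes q: "0 < q" "q < 1"
  shows "infsum (\<lambda>ab. q powi core3_energy ab) UNIV * qprod q (- q) = qprod (q ^ 3) (- (q ^ 3)) ^ 3"
proof -
  define w where "w = q ^ 3"
  have w: "0 < w" "w < 1" using q by (auto simp: w_def power_less_one_iff)
  have d: "w / q = q ^ 2" "w / q ^ 2 = q"
    using q by (simp_all add: w_def power3_eq_cube power2_eq_square)
  have one: "theta q 1 = qprod q (- q) * (qprod q 1 * qprod q q)"
    using jacobi_triple_product[OF q, of 1] by simp
  have "theta w 1 * (theta w q * theta w (q ^ 2)) =
      qprod w (- w) ^ 3 * (qprod w 1 * qprod w (1 * q) * qprod w (1 * q ^ 2)) *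
        (qprod w q * qprod w (q * q) * qprod w (q * q ^ 2))"
  proof -
    have "q * q = q ^ 2" "q * q ^ 2 = w" by (simp_all add: w_def power2_eq_square power3_eq_cube)
    then show ?thesis
      using q d jacobi_triple_product[OF w, of 1] jacobi_triple_product[OF w, of q]
        jacobi_triple_product[OF w, of "q ^ 2"]
      by (simp add: power3_eq_cube)
  qed
  also have "\<dots> = qprod w (- w) ^ 3 * (qprod q 1 * qprod q q)"
    unfolding qprod_triple[OF q, of 1] qprod_triple[OF q, of q] w_def by simp
  finally have "infsum (\<lambda>ab. q powi core3_energy ab) UNIV * qprod q (- q) * (qprod q 1 * qprod q q) =
      qprod w (- w) ^ 3 * (qprod q 1 * qprod q q)"
    using core3_sum_times_theta(2)[OF q] unfolding one w_def by (simp add: mult_ac)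
  moreover have "qprod q 1 * qprod q q \<noteq> 0"
    using qprod_pos[OF q, of 1] qprod_pos[OF q, of q] q by simp
  ultimately show ?thesis by (simp add: w_def)
qed

theorem core3_sum_eq_lambert:
  fixes q :: real
  assumes q: "0 < q" "q < 1"
  shows "infsum (\<lambda>ab. q powi core3_energy ab) UNIV = (\<Sum>\<^sub>\<infinity>n. q powi n / (1 - q powi (3 * n + 1)))"
proof -
  have "qprod q (- q) \<noteq> 0" using qprod_pos[OF q, of "- q"] q by simp
  moreover have "infsum (\<lambda>ab. q powi core3_energy ab) UNIV * qprod q (- q) =
      (\<Sum>\<^sub>\<infinity>n. q powi n / (1 - q powi (3 * n + 1))) * qprod q (- q)"
    using core3_sum_eq_product[OF q] lambert_series_eq_product[OF q] by metis
  ultimately show ?thesis by (rule mult_right_cancel[THEN iffD1])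
qed

text \<open>
The size of a triple is additive, so its generating function is the cube of the one for 3-cores.
\<close>

lemma core_triples_generating_function:
  fixes q :: real
  assumes q: "0 < q" "q < 1"
  shows "((\<lambda>n. real (B3 n) * q ^ n) has_sum infsum (\<lambda>ab. q powi core3_energy ab) UNIV ^ 3) UNIV"
proof -
  define C where "C = {l. is_core 3 l}"
  define T where "T = infsum (\<lambda>ab. q powi core3_energy ab) UNIV"
  have e: "q powi core3_energy (core3_coords l) = q ^ sum_list l" if "l \<in> C" for l
    using sum_list_core3[of l] that by (simp add: C_def flip: power_int_of_nat)
  have bij: "bij_betw core3_coords C UNIV" unfolding C_def by (rule bij_betw_core3_coords)
  have s1: "(\<lambda>l. q ^ sum_list l) summable_on C"
    using summable_on_reindex_bij_betw[OF bij, of "\<lambda>ab. q powi core3_energy ab"] core3_sum_times_theta(1)[OF q]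
      summable_on_cong[of C, OF e] by simp
  have i1: "infsum (\<lambda>l. q ^ sum_list l) C = T"
    using infsum_reindex_bij_betw[OF bij, of "\<lambda>ab. q powi core3_energy ab"] infsum_cong[of C, OF e]
    by (simp add: T_def)
  note p2 = infsum_product[OF s1 s1]
  note p3 = infsum_product[OF s1 p2(1)]
  define f where "f = (\<lambda>x. case x of (a, b, c) \<Rightarrow> q ^ (sum_list a + sum_list b + sum_list c))"
  define d where "d = (\<lambda>x :: nat list \<times> nat list \<times> nat list. case x of (a, b, c) \<Rightarrow> sum_list a + sum_list b + sum_list c)"
  have f: "(case x of (a, y) \<Rightarrow> q ^ sum_list a * (case y of (b, c) \<Rightarrow> q ^ sum_list b * q ^ sum_list c)) = f x" for x
    by (simp add: f_def power_add split: prod.split)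
  have F: "f summable_on C \<times> C \<times> C" "infsum f (C \<times> C \<times> C) = T ^ 3"
    using p3 p2(2) i1 unfolding f by (simp_all add: power3_eq_cube)
  have tr: "{x \<in> C \<times> C \<times> C. d x = n} = core_triples 3 n" for n
    by (auto simp: core_triples_def C_def d_def)
  have "((\<lambda>n. \<Sum>x\<in>core_triples 3 n. f x) has_sum T ^ 3) UNIV"
    using has_sum_group_by[OF F(1), of d] F(2) finite_core_triples unfolding tr by simp
  moreover have "(\<Sum>x\<in>core_triples 3 n. f x) = real (B3 n) * q ^ n" for n
  proof -
    have "f x = q ^ n" if "x \<in> core_triples 3 n" for x
      using that by (auto simp: core_triples_def f_def)
    then show ?thesis by (simp add: B3_def)
  qed
  ultimately show ?thesis by (simp add: T_def)
qed

section \<open>The cube of the Lambert series\<close>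

definition pole :: "real \<Rightarrow> int \<Rightarrow> real" where
  "pole q n = 1 / (1 - q powi (3 * n + 1))"

lemma pole_denom_nonzero:
  fixes q :: real
  assumes q: "0 < q" "q < 1"
  shows "1 - q powi (3 * n + 1) \<noteq> 0"
proof -
  have "3 * n + 1 \<noteq> 0" by presburger
  then show ?thesis using powi_eq_1_iff[OF q, of "3 * n + 1"] by simp
qed

text \<open>
For negative index the denominator is large, which gives the exponential decay that compensates the
growth of negative powers of \<open>q\<close>.
\<close>

lemma pole_bounds:
  fixes q :: real
  assumes q: "0 < q" "q < 1"
  shows "\<bar>pole q (int n)\<bar> \<le> 1 / (1 - q)" "\<bar>pole q (- int n)\<bar> \<le> q powi (3 * int n - 1) / (1 - q)"
proof -
  have le: "q powi (3 * int n + 1) \<le> q" for n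
    using power_decreasing[of 1 "3 * n + 1" q] q by (simp add: nat_add_distrib power_int_def nat_mult_distrib)
  have "1 - q \<le> 1 - q powi (3 * int n + 1)" using le[of n] by simp
  then show nonneg: "\<bar>pole q (int n)\<bar> \<le> 1 / (1 - q)" 
    using q unfolding pole_def by (simp add: frac_le)
  show "\<bar>pole q (- int n)\<bar> \<le> q powi (3 * int n - 1) / (1 - q)"
  proof (cases n)
    case 0
    have "1 \<le> q powi (- 1)" using q by (simp add: power_int_minus one_le_inverse)
    then have "1 / (1 - q) \<le> q powi (- 1) / (1 - q)" using q by (intro divide_right_mono) auto
    moreover have "\<bar>pole q 0\<bar> = 1 / (1 - q)" using q by (simp add: pole_def)
    ultimately show ?thesis using 0 by simp
  next
    case (Suc m)
    define t where "t = q powi (3 * int n - 1)"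
    have "t = q ^ (3 * m + 2)"
      unfolding t_def Suc by (simp add: power_int_def nat_add_distrib nat_mult_distrib algebra_simps)
    then have t: "0 < t" "t \<le> q" using q power_decreasing[of 1 "3 * m + 2" q] by auto
    have "3 * (- int n) + 1 = - (3 * int n - 1)" by simp
    then have "pole q (- int n) = 1 / (1 - inverse t)"
      unfolding pole_def t_def by (simp only: power_int_minus)
    also have "\<dots> = - (t / (1 - t))" using t q by (simp add: field_simps)
    finally have "\<bar>pole q (- int n)\<bar> = t / (1 - t)" using t q by simp
    also have "\<dots> \<le> t / (1 - q)" using t q by (intro divide_left_mono) auto
    finally show ?thesis unfolding t_def .
  qed
qed

text \<open>
The condition \<open>0 < j\<close> gives convergence for large positive \<open>n\<close>, and \<open>j < 3 i\<close> for large negative \<open>n\<close>,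
where the summand is of the order of \<open>q\<^bsup>(j - 3 i) n\<^esup>\<close>.
\<close>

lemma summable_powi_pole:
  fixes q :: real
  assumes q: "0 < q" "q < 1"
    and "0 < j" "j < 3 * i"
  shows "(\<lambda>n. q powi (int j * n) * pole q n ^ i) summable_on UNIV"
proof (rule summable_on_int_geometric[of q _ "1 / (q * (1 - q)) ^ i"])
  show "0 \<le> q" "q < 1" using q by auto
  have qi: "q ^ i \<le> 1" using q by (simp add: power_le_one)
  have c: "1 / (1 - q) ^ i \<le> 1 / (q * (1 - q)) ^ i"
    using q qi by (intro divide_left_mono) (auto simp: power_mult_distrib mult_le_cancel_right1)
  fix n :: nat
  have "\<bar>q powi (int j * int n) * pole q (int n) ^ i\<bar> = q ^ (j * n) * \<bar>pole q (int n)\<bar> ^ i"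
    using q by (simp add: abs_mult power_abs power_int_of_nat flip: of_nat_mult)
  also have "\<dots> \<le> q ^ n * (1 / (1 - q)) ^ i"
    using q pole_bounds(1)[OF q, of n] assms by (intro mult_mono power_mono power_decreasing) auto
  also have "\<dots> \<le> q ^ n * (1 / (q * (1 - q)) ^ i)"
    using q c by (intro mult_left_mono) (auto simp: power_divide)
  finally show "\<bar>q powi (int j * int n) * pole q (int n) ^ i\<bar> \<le> 1 / (q * (1 - q)) ^ i * q ^ n"
    by (simp add: mult.commute)
  have "\<bar>q powi (int j * - int n) * pole q (- int n) ^ i\<bar> = q powi (- (int j * int n)) * \<bar>pole q (- int n)\<bar> ^ i"
    using q by (simp add: abs_mult power_abs)
  also have "\<dots> \<le> q powi (- (int j * int n)) * (q powi (3 * int n - 1) / (1 - q)) ^ i"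
    using q pole_bounds(2)[OF q, of n] by (intro mult_left_mono power_mono) auto
  also have "\<dots> = q powi ((3 * int i - int j) * int n) * (1 / (q * (1 - q)) ^ i)"
  proof -
    have "q powi (3 * int n - 1) = q powi (3 * int n) / q"
      using q by (simp add: power_int_diff)
    then have "(q powi (3 * int n - 1)) ^ i = q powi (3 * int n * int i) / q ^ i"
      by (simp only: power_divide power_int_power')
    moreover have "q powi ((3 * int i - int j) * int n) =
        q powi (- (int j * int n)) * q powi (3 * int n * int i)"
      using q by (simp add: algebra_simps flip: power_int_add)
    ultimately show ?thesis by (simp add: power_divide power_mult_distrib)
  qed
  also have "\<dots> \<le> q ^ n * (1 / (q * (1 - q)) ^ i)"
  proof -
    have "(3 * int i - int j) * int n = int ((3 * i - j) * n)" using assms by simp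
    then have "q powi ((3 * int i - int j) * int n) = q ^ ((3 * i - j) * n)"
      by (simp only: power_int_of_nat)
    also have "\<dots> \<le> q ^ n" using q assms by (intro power_decreasing) auto
    finally show ?thesis using q by (intro mult_right_mono) auto
  qed
  finally show "\<bar>q powi (int j * - int n) * pole q (- int n) ^ i\<bar> \<le> 1 / (q * (1 - q)) ^ i * q ^ n"
    by (simp add: mult.commute)
qed

text \<open>
The Lambert series is \<open>pole_sum 1 1\<close>.
\<close>

definition pole_sum :: "real \<Rightarrow> nat \<Rightarrow> nat \<Rightarrow> real" where
  "pole_sum q j i = (\<Sum>\<^sub>\<infinity>n. q powi (int j * n) * pole q n ^ i)"

text \<open>
The coefficients depend only on the difference \<open>k\<close> of the indices.
\<close>

lemma partial_fractions:
  fixes q :: real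
  assumes q: "0 < q" "q < 1"
    and "k \<noteq> 0"
  shows "pole q n * pole q (n + k) = pole q n / (1 - q powi (3 * k)) + pole q (n + k) * (1 - 1 / (1 - q powi (3 * k)))"
proof -
  define x y where "x = q powi (3 * n + 1)" and "y = q powi (3 * k)"
  have xy: "q powi (3 * (n + k) + 1) = x * y"
    unfolding x_def y_def using q by (simp add: algebra_simps flip: power_int_add)
  have "x \<noteq> 0" "y \<noteq> 0" using q by (auto simp: x_def y_def)
  moreover have "1 - x \<noteq> 0" "1 - x * y \<noteq> 0"
    using pole_denom_nonzero[OF q, of n] pole_denom_nonzero[OF q, of "n + k"] xy by (auto simp: x_def)
  moreover have "1 - y \<noteq> 0" using powi_eq_1_iff[OF q, of "3 * k"] assms by (simp add: y_def)
  ultimately show ?thesis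
    unfolding pole_def xy x_def[symmetric] y_def[symmetric]
    by (simp add: divide_simps) (simp add: algebra_simps)
qed

text \<open>
The mechanism behind both multiplication formulas: when every line parallel to the diagonal sums to
zero, only the diagonal contributes.
\<close>

lemma double_sum_by_difference:
  assumes F: "(\<lambda>(n, m). F n m) summable_on (UNIV :: (int \<times> int) set)"
    and zero: "\<And>k. k \<noteq> 0 \<Longrightarrow> (\<Sum>\<^sub>\<infinity>n. F n (n + k)) = (0 :: real)"
  shows "infsum (\<lambda>(n, m). F n m) UNIV = (\<Sum>\<^sub>\<infinity>n. F n n)"
proof -
  have bij: "bij_betw (\<lambda>(k, n). (n, n + k)) (UNIV \<times> UNIV) (UNIV :: (int \<times> int) set)"
    by (rule bij_betwI[of _ _ _ "\<lambda>(n, m). (m - n, n)"]) auto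
  have e: "(case (case p of (k, n) \<Rightarrow> (n, n + k)) of (n, m) \<Rightarrow> F n m) = (case p of (k, n) \<Rightarrow> F n (n + k))"
    for p :: "int \<times> int" by (cases p) simp
  have S: "(\<lambda>(k, n). F n (n + k)) summable_on UNIV \<times> UNIV"
    using summable_on_reindex_bij_betw[OF bij, of "\<lambda>(n, m). F n m"] F unfolding e by simp
  have "infsum (\<lambda>(n, m). F n m) UNIV = infsum (\<lambda>(k, n). F n (n + k)) (UNIV \<times> UNIV)"
    using infsum_reindex_bij_betw[OF bij, of "\<lambda>(n, m). F n m"] unfolding e by simp
  also have "\<dots> = (\<Sum>\<^sub>\<infinity>k. \<Sum>\<^sub>\<infinity>n. F n (n + k))"
    by (rule infsum_Sigma'_banach[OF S, symmetric])
  also have "\<dots> = (\<Sum>\<^sub>\<infinity>k\<in>{0}. \<Sum>\<^sub>\<infinity>n. F n (n + k))"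
    by (rule infsum_cong_neutral) (use zero in auto)
  finally show ?thesis by simp
qed

lemma infsum_shift_int: "(\<Sum>\<^sub>\<infinity>n. f (n + k)) = (\<Sum>\<^sub>\<infinity>n. f (n :: int) :: real)"
  and summable_shift_int: "(\<lambda>n. f (n + k)) summable_on UNIV \<longleftrightarrow> f summable_on UNIV"
proof -
  have bij: "bij_betw (\<lambda>n. n + k) UNIV (UNIV :: int set)"
    by (rule bij_betwI[of _ _ _ "\<lambda>n. n - k"]) auto
  show "(\<Sum>\<^sub>\<infinity>n. f (n + k)) = (\<Sum>\<^sub>\<infinity>n. f n)" by (rule infsum_reindex_bij_betw[OF bij])
  show "(\<lambda>n. f (n + k)) summable_on UNIV \<longleftrightarrow> f summable_on UNIV"
    by (rule summable_on_reindex_bij_betw[OF bij])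
qed

text \<open>pole_sum 2 1 = 0\<close>

text \<open>
Expanding into geometric series, the terms with \<open>n \<ge> 0\<close> give the sum of \<open>q\<^bsup>3nm+2n+m\<^esup>\<close> over natural
numbers \<open>n\<close>, \<open>m\<close>, and those with \<open>n < 0\<close> give its negative with \<open>n\<close> and \<open>m\<close> exchanged.
\<close>

lemma pole_sum_2_1:
  fixes q :: real
  assumes q: "0 < q" "q < 1"
  shows "pole_sum q 2 1 = 0"
proof -
  define f where "f = (\<lambda>n. q powi (2 * n) * pole q n)"
  define g where "g = (\<lambda>(n :: nat, m :: nat). q ^ (3 * n * m + 2 * n + m))"
  have f: "f summable_on UNIV" using summable_powi_pole[OF q, of 2 1] by (simp add: f_def)
  have pos: "((\<lambda>m. g (n, m)) has_sum f (int n)) UNIV" for n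
  proof -
    define r where "r = q ^ (3 * n + 1)"
    have r: "\<bar>r\<bar> < 1" using q power_Suc_less_one[of q "3 * n"] by (simp add: r_def)
    have "((\<lambda>m. q ^ (2 * n) * r ^ m) has_sum q ^ (2 * n) * (1 / (1 - r))) UNIV"
      by (intro has_sum_cmult_right geometric_has_sum r)
    moreover have "q ^ (2 * n) * r ^ m = g (n, m)" for m
      by (simp add: g_def r_def algebra_simps flip: power_add power_mult)
    moreover have "q ^ (2 * n) * (1 / (1 - r)) = f (int n)"
    proof -
      have "q powi (3 * int n + 1) = r" "q powi (2 * int n) = q ^ (2 * n)"
        by (simp_all add: r_def power_int_def nat_add_distrib nat_mult_distrib)
      then show ?thesis by (simp add: f_def pole_def)
    qed
    ultimately show ?thesis by simp
  qed
  have neg: "((\<lambda>m. - g (m, n)) has_sum f (- int (Suc n))) UNIV" for n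
  proof -
    define r where "r = q ^ (3 * n + 2)"
    have r: "\<bar>r\<bar> < 1" "r \<noteq> 0" using q power_Suc_less_one[of q "3 * n + 1"] by (auto simp: r_def)
    have "((\<lambda>m. - (q ^ n) * r ^ m) has_sum - (q ^ n) * (1 / (1 - r))) UNIV"
      by (intro has_sum_cmult_right geometric_has_sum r)
    moreover have "- (q ^ n) * r ^ m = - g (m, n)" for m
      by (simp add: g_def r_def algebra_simps flip: power_add power_mult)
    moreover have "- (q ^ n) * (1 / (1 - r)) = f (- int (Suc n))"
    proof -
      have "3 * (- int (Suc n)) + 1 = - int (3 * n + 2)" "2 * (- int (Suc n)) = - int (2 * n + 2)"
        by simp_all
      then have "f (- int (Suc n)) = inverse (q ^ (2 * n + 2)) * (1 / (1 - inverse r))"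
        unfolding f_def pole_def r_def by (simp only: power_int_minus power_int_of_nat)
      also have "1 / (1 - inverse r) = - (r / (1 - r))" using r by (simp add: field_simps)
      also have "r = q ^ (2 * n + 2) * q ^ n"
        unfolding r_def power_add[symmetric] by (rule arg_cong[of _ _ "power q"]) simp
      also have "inverse (q ^ (2 * n + 2)) * - (q ^ (2 * n + 2) * q ^ n / (1 - q ^ (2 * n + 2) * q ^ n)) =
          - (q ^ n) * (1 / (1 - q ^ (2 * n + 2) * q ^ n))"
      proof -
        have cancel: "inverse t * - (t * c / d) = - c * (1 / d)" if "t \<noteq> 0" for t c d :: real
          using that by (simp add: field_simps)
        show ?thesis by (rule cancel) (use q in simp)
      qed
      finally show ?thesis
        unfolding r_def power_add[symmetric] by (simp add: algebra_simps)
    qed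
    ultimately show ?thesis by simp
  qed
  have "f summable_on range int" "f summable_on range (\<lambda>n. - int (Suc n))"
    using f by (auto intro: summable_on_subset_banach)
  then have sf: "(\<lambda>n. f (int n)) summable_on UNIV" "(\<lambda>n. f (- int (Suc n))) summable_on UNIV"
    by (simp_all add: summable_on_reindex inj_on_def o_def)
  have g: "g summable_on UNIV \<times> UNIV"
  proof -
    have g0: "0 \<le> g p" for p using q by (simp add: g_def split: prod.split)
    have "(\<lambda>p. norm (g p)) summable_on UNIV \<times> UNIV"
      unfolding Infinite_Sum.abs_summable_on_Sigma_iff
    proof (intro conjI ballI)
      show "(\<lambda>m. norm (g (n, m))) summable_on UNIV" for n
        using has_sum_imp_summable[OF pos[of n]] g0 by simp
      have "(\<Sum>\<^sub>\<infinity>m. norm (g (n, m))) = f (int n)" for n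
        using infsumI[OF pos[of n]] g0 by simp
      then show "(\<lambda>n. norm (\<Sum>\<^sub>\<infinity>m. norm (g (n, m)))) summable_on UNIV"
        using summable_on_iff_abs_summable_on_real[THEN iffD1, OF sf(1)] by simp
    qed
    then show ?thesis using g0 by simp
  qed
  \<comment> \<open>The index \<open>- int (Suc n)\<close> makes the two halves disjoint.\<close>
  have UN: "UNIV = range int \<union> range (\<lambda>n. - int (Suc n))"
  proof -
    have "x \<in> range int \<union> range (\<lambda>n. - int (Suc n))" for x
      by (cases x) (auto simp del: of_nat_Suc)
    then show ?thesis by blast
  qed
  have "pole_sum q 2 1 = infsum f UNIV" by (simp add: pole_sum_def f_def)
  also have "\<dots> = infsum f (range int) + infsum f (range (\<lambda>n. - int (Suc n)))"
    unfolding UN using f by (intro infsum_Un_disjoint) (auto intro: summable_on_subset_banach)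
  also have "infsum f (range int) = (\<Sum>\<^sub>\<infinity>n. f (int n))"
    by (simp add: infsum_reindex o_def)
  also have "infsum f (range (\<lambda>n. - int (Suc n))) = (\<Sum>\<^sub>\<infinity>n. f (- int (Suc n)))"
    by (subst infsum_reindex) (auto simp: inj_on_def o_def)
  also have "(\<Sum>\<^sub>\<infinity>n. f (int n)) = (\<Sum>\<^sub>\<infinity>n. \<Sum>\<^sub>\<infinity>m. g (n, m))"
    using infsumI[OF pos] by simp
  also have "\<dots> = (\<Sum>\<^sub>\<infinity>n. \<Sum>\<^sub>\<infinity>m. g (m, n))"
    using infsum_swap_banach[of "\<lambda>n m. g (n, m)" UNIV UNIV] g by simp
  also have "(\<Sum>\<^sub>\<infinity>n. f (- int (Suc n))) = - (\<Sum>\<^sub>\<infinity>n. \<Sum>\<^sub>\<infinity>m. g (m, n))"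
  proof -
    have "f (- int (Suc n)) = - (\<Sum>\<^sub>\<infinity>m. g (m, n))" for n
      using infsumI[OF neg[of n]] by (simp only: infsum_uminus)
    then show ?thesis by (simp only: infsum_uminus)
  qed
  finally show ?thesis by simp
qed

lemma pole_sum_product:
  fixes q :: real
  assumes q: "0 < q" "q < 1"
    and "0 < j" "j < 3 * i" "0 < j'" "j' < 3 * i'"
  shows "(\<lambda>(n, m). q powi (int j * n) * pole q n ^ i * (q powi (int j' * m) * pole q m ^ i')) summable_on UNIV"
    and "infsum (\<lambda>(n, m). q powi (int j * n) * pole q n ^ i * (q powi (int j' * m) * pole q m ^ i')) UNIV = pole_sum q j i * pole_sum q j' i'"
  using infsum_product[OF summable_powi_pole[OF q assms(3,4)] summable_powi_pole[OF q assms(5,6)]]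
  by (simp_all add: pole_sum_def)

text \<open>
Off the diagonal, partial fractions leave multiples of \<open>pole_sum 2 1 = 0\<close>.
\<close>

lemma pole_sum_1_1_squared:
  fixes q :: real
  assumes q: "0 < q" "q < 1"
  shows "pole_sum q 1 1 ^ 2 = pole_sum q 2 2"
proof -
  define F where "F = (\<lambda>n m. q powi n * pole q n * (q powi m * pole q m))"
  have F: "(\<lambda>(n, m). F n m) summable_on UNIV" "infsum (\<lambda>(n, m). F n m) UNIV = pole_sum q 1 1 * pole_sum q 1 1"
    using pole_sum_product[OF q, of 1 1 1 1] by (simp_all add: F_def)
  have "(\<Sum>\<^sub>\<infinity>n. F n (n + k)) = 0" if "k \<noteq> 0" for k
  proof -
    define u where "u = 1 / (1 - q powi (3 * k))"
    define f where "f = (\<lambda>n. q powi (2 * n) * pole q n)"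
    have f: "f summable_on UNIV" "infsum f UNIV = 0"
      using summable_powi_pole[OF q, of 2 1] pole_sum_2_1[OF q] by (simp_all add: f_def pole_sum_def)
    have e: "F n (n + k) = q powi k * u * f n + q powi (- k) * (1 - u) * f (n + k)" for n
    proof -
      have "2 * n + k = n + (n + k)" by simp
      then have "q powi (2 * n + k) = q powi n * q powi (n + k)" by (simp only: powi_add_q[OF q])
      then have "F n (n + k) = q powi (2 * n + k) * (pole q n * pole q (n + k))"
        by (simp only: F_def mult_ac)
      also have "\<dots> = q powi (2 * n + k) * (pole q n * u + pole q (n + k) * (1 - u))"
        unfolding partial_fractions[OF q that] u_def by simp
      also have "\<dots> = q powi k * u * f n + q powi (2 * n + k) * ((1 - u) * pole q (n + k))"
        using q by (simp add: f_def power_int_add algebra_simps)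
      also have "q powi (2 * n + k) = q powi (- k) * q powi (2 * (n + k))"
      proof -
        have idx: "2 * n + k = - k + 2 * (n + k)" by simp
        show ?thesis unfolding idx by (rule powi_add_q[OF q])
      qed
      finally show ?thesis by (simp add: f_def mult_ac)
    qed
    show ?thesis
      unfolding e using f
      by (subst infsum_add) (auto simp: infsum_cmult_right' infsum_shift_int summable_shift_int
          intro!: summable_on_cmult_right)
  qed
  from double_sum_by_difference[OF F(1) this] have "pole_sum q 1 1 * pole_sum q 1 1 = (\<Sum>\<^sub>\<infinity>n. F n n)"
    using F(2) by simp
  also have "\<dots> = pole_sum q 2 2"
    unfolding pole_sum_def
  proof (rule infsum_cong)
    fix n :: int
    have "int 2 * n = n + n" by simp
    then have "q powi (int 2 * n) = q powi n * q powi n" by (simp only: powi_add_q[OF q])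
    then show "F n n = q powi (int 2 * n) * pole q n ^ 2"
      by (simp only: F_def power2_eq_square mult_ac)
  qed
  finally show ?thesis by (simp add: power2_eq_square)
qed

text \<open>
The cube is \<open>pole_sum 2 2 * pole_sum 1 1\<close>.  Two products with the vanishing factor \<open>pole_sum 2 1\<close> are
added such that the summand becomes \<open>A\<^sub>n A\<^sub>m (A\<^sub>n + A\<^sub>m - 1)\<close>, where \<open>A\<close> abbreviates \<open>pole\<close>.  By partial
fractions this is \<open>u A\<^sub>n\<^sup>2 + (1 - u) A\<^sub>m\<^sup>2\<close>, and the two parts cancel along each line \<open>m = n + k\<close>.  Without the
correction, linear terms \<open>q\<^bsup>3n\<^esup> A\<^sub>n\<close> would remain, whose sum over all integers diverges.
\<close>

lemma pole_sum_1_1_cubed: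
  fixes q :: real
  assumes q: "0 < q" "q < 1"
  shows "pole_sum q 1 1 ^ 3 = (\<Sum>\<^sub>\<infinity>n. q powi (3 * n) * (2 * pole q n ^ 3 - pole q n ^ 2))"
proof -
  define F where "F = (\<lambda>n m. q powi (2 * n + m) * (pole q n * pole q m * (pole q n + pole q m - 1)))"
  define F1 where "F1 = (\<lambda>n m. q powi (2 * n) * pole q n ^ 2 * (q powi m * pole q m))"
  define F2 where "F2 = (\<lambda>n m. q powi (2 * n) * pole q n * (q powi m * pole q m ^ 2))"
  \<comment> \<open>The first series sums to the cube; the sums of the next two contain the factor \<open>pole_sum 2 1\<close>.\<close>
  define F3 where "F3 = (\<lambda>n m. q powi (2 * n) * pole q n * (q powi m * pole q m))"
  note s1 = pole_sum_product[OF q, of 2 2 1 1, simplified, folded F1_def]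
  note s2 = pole_sum_product[OF q, of 2 1 1 2, simplified, folded F2_def]
  note s3 = pole_sum_product[OF q, of 2 1 1 1, simplified, folded F3_def]
  have e: "(case p of (n, m) \<Rightarrow> F n m) = (case p of (n, m) \<Rightarrow> F1 n m) + (case p of (n, m) \<Rightarrow> F2 n m)
      + - (case p of (n, m) \<Rightarrow> F3 n m)" for p
    using q by (cases p) (simp add: F_def F1_def F2_def F3_def power_int_add power2_eq_square algebra_simps)
  have F1': "(\<lambda>p. case p of (n, m) \<Rightarrow> F1 n m) summable_on UNIV"
    "infsum (\<lambda>p. case p of (n, m) \<Rightarrow> F1 n m) UNIV = pole_sum q 2 2 * pole_sum q 1 1"
    using s1 by (simp_all add: F1_def)
  have F2': "(\<lambda>p. case p of (n, m) \<Rightarrow> F2 n m) summable_on UNIV"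
    "infsum (\<lambda>p. case p of (n, m) \<Rightarrow> F2 n m) UNIV = pole_sum q 2 1 * pole_sum q 1 2"
    using s2 by (simp_all add: F2_def)
  have F3': "(\<lambda>p. - (case p of (n, m) \<Rightarrow> F3 n m)) summable_on UNIV"
    "infsum (\<lambda>p. - (case p of (n, m) \<Rightarrow> F3 n m)) UNIV = - (pole_sum q 2 1 * pole_sum q 1 1)"
    using s3 by (simp_all add: F3_def summable_on_uminus infsum_uminus)
  have F: "(\<lambda>(n, m). F n m) summable_on UNIV"
    unfolding e by (intro summable_on_add F1' F2' F3')
  have "infsum (\<lambda>(n, m). F n m) UNIV = pole_sum q 2 2 * pole_sum q 1 1 + pole_sum q 2 1 * pole_sum q 1 2 + - (pole_sum q 2 1 * pole_sum q 1 1)"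
    unfolding e F1'(2)[symmetric] F2'(2)[symmetric] F3'(2)[symmetric]
    by (subst infsum_add, intro summable_on_add F1' F2', rule F3', subst infsum_add, rule F1', rule F2', rule refl)
  also have "\<dots> = pole_sum q 1 1 ^ 3"
    by (simp add: pole_sum_2_1[OF q] pole_sum_1_1_squared[OF q, symmetric] power3_eq_cube power2_eq_square del: One_nat_def)
  finally have total: "infsum (\<lambda>(n, m). F n m) UNIV = pole_sum q 1 1 ^ 3" .
  have "(\<Sum>\<^sub>\<infinity>n. F n (n + k)) = 0" if "k \<noteq> 0" for k
  proof -
    define u where "u = 1 / (1 - q powi (3 * k))"
    define g where "g = (\<lambda>n. q powi (3 * n) * pole q n ^ 2)"
    have g: "g summable_on UNIV"
      using summable_powi_pole[OF q, of 3 2] by (simp add: g_def)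
    have "1 - q powi (3 * k) \<noteq> 0" using powi_eq_1_iff[OF q, of "3 * k"] that by simp
    then have u: "1 - u = - (q powi (3 * k) * u)" by (simp add: u_def field_simps)
    have e: "F n (n + k) = q powi k * u * g n + - (q powi k * u) * g (n + k)" for n
    proof -
      have pf: "pole q n * pole q (n + k) = pole q n * u + pole q (n + k) * (1 - u)"
        unfolding partial_fractions[OF q that] u_def by simp
      have "pole q n * pole q (n + k) * (pole q n + pole q (n + k) - 1) =
          (pole q n * u + pole q (n + k) * (1 - u)) * (pole q n + pole q (n + k)) - pole q n * pole q (n + k)"
        unfolding pf[symmetric] by (simp add: algebra_simps)
      also have "\<dots> = u * pole q n ^ 2 + (1 - u) * pole q (n + k) ^ 2"
        by (simp add: algebra_simps power2_eq_square)
      finally have "F n (n + k) = q powi (2 * n + (n + k)) * (u * pole q n ^ 2 + (1 - u) * pole q (n + k) ^ 2)"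
        by (simp only: F_def)
      moreover have "2 * n + (n + k) = 3 * n + k" by simp
      ultimately have "F n (n + k) = q powi (3 * n + k) * (u * pole q n ^ 2 + (1 - u) * pole q (n + k) ^ 2)"
        by (simp only:)
      also have "\<dots> = q powi (3 * n) * q powi k * (u * pole q n ^ 2)
          - q powi (3 * n) * q powi k * q powi (3 * k) * u * pole q (n + k) ^ 2"
        unfolding u using q by (simp add: power_int_add algebra_simps)
      also have "q powi (3 * n) * q powi k * q powi (3 * k) = q powi k * q powi (3 * (n + k))"
        using q by (simp add: algebra_simps flip: power_int_add)
      finally show ?thesis by (simp add: g_def mult_ac)
    qed
    define c where "c = q powi k * u"
    have "(\<Sum>\<^sub>\<infinity>n. c * g n + - c * g (n + k)) = (\<Sum>\<^sub>\<infinity>n. c * g n) + (\<Sum>\<^sub>\<infinity>n. - c * g (n + k))"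
      by (intro infsum_add summable_on_cmult_right g summable_shift_int[THEN iffD2])
    also have "\<dots> = c * infsum g UNIV + - c * infsum g UNIV"
      unfolding infsum_cmult_right' infsum_shift_int[of g k] ..
    finally show ?thesis unfolding e c_def[symmetric] by simp
  qed
  from double_sum_by_difference[OF F this] total have "pole_sum q 1 1 ^ 3 = (\<Sum>\<^sub>\<infinity>n. F n n)" by simp
  also have "\<dots> = (\<Sum>\<^sub>\<infinity>n. q powi (3 * n) * (2 * pole q n ^ 3 - pole q n ^ 2))"
    by (intro infsum_cong) (simp add: F_def power2_eq_square power3_eq_cube algebra_simps)
  finally show ?thesis .
qed

section \<open>Core triples as a twisted divisor sum\<close>

lemma squares_power_series:
  fixes t :: real
  assumes "\<bar>t\<bar> < 1"
  shows "(\<lambda>k. real k ^ 2 * t ^ k) sums (t * (1 + t) / (1 - t) ^ 3)"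
proof -
  have d1: "(\<lambda>n. real (Suc n) * z ^ n) sums (1 / (1 - z) ^ 2)" if "norm z < 1" for z :: real
    using geometric_deriv_sums[of z] that by simp
  have der: "((\<lambda>z. 1 / (1 - z) ^ 2) has_field_derivative 2 / (1 - t) ^ 3) (at t)"
    using assms by (auto intro!: derivative_eq_intros simp: divide_simps power2_eq_square power3_eq_cube)
  have "(\<lambda>n. diffs (\<lambda>n. real (Suc n)) n * t ^ n) sums (2 / (1 - t) ^ 3)"
    by (rule termdiffs_sums_strong[OF d1 der]) (use assms in auto)
  from sums_mult[OF sums_diff[OF this d1[of t]], of t] assms
  have "(\<lambda>n. t * (diffs (\<lambda>n. real (Suc n)) n * t ^ n - real (Suc n) * t ^ n)) sums
      (t * (2 / (1 - t) ^ 3 - 1 / (1 - t) ^ 2))" by simp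
  moreover have eq: "t * (diffs (\<lambda>n. real (Suc n)) n * t ^ n - real (Suc n) * t ^ n) =
      real (Suc n) ^ 2 * t ^ Suc n" for n
    by (simp add: diffs_def power2_eq_square algebra_simps)
  moreover have "t * (2 / (1 - t) ^ 3 - 1 / (1 - t) ^ 2) = t * (1 + t) / (1 - t) ^ 3"
    using assms by (simp add: divide_simps power2_eq_square power3_eq_cube) algebra
  ultimately have "(\<lambda>n. real (Suc n) ^ 2 * t ^ Suc n) sums (t * (1 + t) / (1 - t) ^ 3)"
    by (simp only: eq)
  then show ?thesis by (subst (asm) sums_Suc_iff) simp
qed

definition chi3 :: "nat \<Rightarrow> int" where
  "chi3 j = (if j mod 3 = 1 then 1 else if j mod 3 = 2 then -1 else 0)"

text \<open>
These numbers are the coefficients of the Eisenstein series of weight 3 for the character \<open>chi3\<close> that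
vanishes at the cusp at infinity.
\<close>

definition twisted_divisor_sum :: "nat \<Rightarrow> int" where
  "twisted_divisor_sum n = (\<Sum>(j, k)\<in>{(j, k). 1 \<le> j \<and> 1 \<le> k \<and> j * k = n}. chi3 j * int k ^ 2)"

text \<open>
The numbers 1, 4, 7, ... come from \<open>n \<ge> 0\<close> and the numbers 2, 5, 8, ... from \<open>n < 0\<close>.
\<close>

lemma bij_abs_arith_progression: "bij_betw (\<lambda>n. nat \<bar>3 * n + 1\<bar>) UNIV {j. \<not> 3 dvd j}"
proof (rule bij_betwI[of _ _ _ "\<lambda>j. if j mod 3 = 1 then int (j div 3) else - int (j div 3) - 1"])
  show "(\<lambda>n. nat \<bar>3 * n + 1\<bar>) \<in> UNIV \<rightarrow> {j. \<not> 3 dvd j}"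
    by (auto simp: nat_dvd_iff) presburger+
next
  fix n :: int
  show "(if nat \<bar>3 * n + 1\<bar> mod 3 = 1 then int (nat \<bar>3 * n + 1\<bar> div 3)
      else - int (nat \<bar>3 * n + 1\<bar> div 3) - 1) = n"
  proof (cases "0 \<le> n")
    case True
    then obtain m where "n = int m" using nonneg_int_cases by blast
    then have "nat \<bar>3 * n + 1\<bar> = 3 * m + 1" by simp
    then show ?thesis using \<open>n = int m\<close> by simp
  next
    case False
    define m where "m = nat (- n - 1)"
    have n: "n = - int m - 1" using False by (simp add: m_def)
    then have "nat \<bar>3 * n + 1\<bar> = 3 * m + 2" by simp
    moreover have "(3 * m + 2) mod 3 = 2" "(3 * m + 2) div 3 = m" by presburger+
    ultimately show ?thesis using n by simp
  qed
next
  fix j :: nat assume "j \<in> {j. \<not> 3 dvd j}"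
  then have "j = 3 * (j div 3) + 1 \<or> j = 3 * (j div 3) + 2" by (simp add: dvd_eq_mod_eq_0) presburger
  then obtain d where d: "j = 3 * d + 1 \<or> j = 3 * d + 2" by blast
  have "(3 * d + 1) mod 3 = 1" "(3 * d + 1) div 3 = d" "(3 * d + 2) mod 3 = 2" "(3 * d + 2) div 3 = d"
    by (simp_all, presburger)
  with d show "nat \<bar>3 * (if j mod 3 = 1 then int (j div 3) else - int (j div 3) - 1) + 1\<bar> = j"
    by (elim disjE) (simp_all only:, simp_all)
qed auto

text \<open>
For \<open>t = q\<^bsup>3n+1\<^esup>\<close> the summand of \<open>pole_sum_1_1_cubed\<close>, multiplied by \<open>q\<close>, is \<open>t (1 + t) / (1 - t)\<^sup>3\<close>.
This function changes sign under \<open>t \<mapsto> 1 / t\<close>, so a negative \<open>n\<close> contributes the negative of its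
value at \<open>q\<^bsup>-3n-1\<^esup>\<close>; in all cases the sign is \<open>chi3 \<bar>3 n + 1\<bar>\<close>.
\<close>

lemma eisenstein_expansion:
  fixes q :: real
  assumes q: "0 < q" "q < 1"
  shows "((\<lambda>n. real_of_int (twisted_divisor_sum n) * q ^ n) has_sum q * pole_sum q 1 1 ^ 3) UNIV"
proof -
  define L where "L = (\<lambda>t. t * (1 + t) / (1 - t) ^ 3 :: real)"
  define f where "f = (\<lambda>(j, k). real_of_int (chi3 j) * (real k ^ 2 * q ^ (j * k)))"
  let ?P = "{1::nat..} \<times> {1::nat..}"
  have unit: "0 < q ^ j" "q ^ j < 1" "q ^ j \<le> q" if "1 \<le> j" for j
    using that q power_decreasing[of 1 j q] by (auto simp: power_less_one_iff)
  have row: "((\<lambda>k. real k ^ 2 * q ^ (j * k)) has_sum L (q ^ j)) {1..}" if "1 \<le> j" for j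
  proof -
    have "((\<lambda>k. real k ^ 2 * (q ^ j) ^ k) has_sum L (q ^ j)) UNIV"
      unfolding L_def using unit[OF that]
      by (intro sums_nonneg_imp_has_sum squares_power_series) auto
    moreover have "((\<lambda>k. real k ^ 2 * (q ^ j) ^ k) has_sum L (q ^ j)) UNIV \<longleftrightarrow>
        ((\<lambda>k. real k ^ 2 * q ^ (j * k)) has_sum L (q ^ j)) {1..}"
      by (rule has_sum_cong_neutral) (auto simp: power_mult)
    ultimately show ?thesis by simp
  qed
  have frow: "((\<lambda>k. f (j, k)) has_sum real_of_int (chi3 j) * L (q ^ j)) {1..}" if "1 \<le> j" for j
    unfolding f_def prod.case by (intro has_sum_cmult_right row that)
  have chi: "\<bar>real_of_int (chi3 j)\<bar> \<le> 1" for j by (simp add: chi3_def)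
  have F: "f summable_on ?P"
  proof -
    have nonneg: "0 \<le> L (q ^ j)" if "1 \<le> j" for j using unit[OF that] by (simp add: L_def)
    have nrow: "((\<lambda>k. norm (f (j, k))) has_sum \<bar>real_of_int (chi3 j)\<bar> * L (q ^ j)) {1..}" if "1 \<le> j" for j
    proof -
      have "norm (f (j, k)) = \<bar>real_of_int (chi3 j)\<bar> * (real k ^ 2 * q ^ (j * k))" for k
        using q by (simp add: f_def abs_mult)
      then show ?thesis using has_sum_cmult_right[OF row[OF that], of "\<bar>real_of_int (chi3 j)\<bar>"] by simp
    qed
    have "(\<lambda>j. 2 / (1 - q) ^ 3 * q ^ j) summable_on {1..}"
      using has_sum_imp_summable[OF geometric_has_sum[of q]] q
      by (intro summable_on_cmult_right) (auto intro: summable_on_subset_banach)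
    then have "(\<lambda>j. \<bar>real_of_int (chi3 j)\<bar> * L (q ^ j)) summable_on {1..}"
    proof (rule summable_on_bounded_by)
      fix j :: nat assume "j \<in> {1..}"
      then have j: "1 \<le> j" by simp
      have "L (q ^ j) \<le> q ^ j * 2 / (1 - q) ^ 3"
        unfolding L_def using unit[OF j] q by (intro frac_le mult_left_mono power_mono) auto
      moreover have "\<bar>real_of_int (chi3 j)\<bar> * L (q ^ j) \<le> 1 * L (q ^ j)"
        using chi nonneg[OF j] by (intro mult_right_mono) auto
      ultimately show "\<bar>\<bar>real_of_int (chi3 j)\<bar> * L (q ^ j)\<bar> \<le> 2 / (1 - q) ^ 3 * q ^ j"
        using nonneg[OF j] by (simp add: abs_mult mult.commute)
    qed
    moreover have "norm (\<Sum>\<^sub>\<infinity>k\<in>{1..}. norm (f (j, k))) = \<bar>real_of_int (chi3 j)\<bar> * L (q ^ j)"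
      if "j \<in> {1..}" for j
    proof -
      have j: "1 \<le> j" using that by simp
      show ?thesis unfolding infsumI[OF nrow[OF j]] using nonneg[OF j] by (simp add: abs_mult)
    qed
    ultimately have "(\<lambda>j. norm (\<Sum>\<^sub>\<infinity>k\<in>{1..}. norm (f (j, k)))) summable_on {1..}"
      by (subst summable_on_cong)
    then have "(\<lambda>p. norm (f p)) summable_on ?P"
      unfolding Infinite_Sum.abs_summable_on_Sigma_iff using has_sum_imp_summable[OF nrow] by auto
    then show ?thesis by (rule summable_on_iff_abs_summable_on_real[THEN iffD2])
  qed
  have total: "infsum f ?P = q * pole_sum q 1 1 ^ 3"
  proof -
    define h where "h = (\<lambda>j. real_of_int (chi3 j) * L (q ^ j))"
    have "infsum f ?P = (\<Sum>\<^sub>\<infinity>j\<in>{1..}. \<Sum>\<^sub>\<infinity>k\<in>{1..}. f (j, k))"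
      by (rule infsum_Sigma_banach[OF F, symmetric])
    also have "\<dots> = infsum h {1..}"
      unfolding h_def by (rule infsum_cong, rule infsumI, rule frow) simp
    also have "\<dots> = infsum h {j. \<not> 3 dvd j}"
    proof (rule infsum_cong_neutral)
      show "h j = 0" if "j \<in> {1..} - {j. \<not> 3 dvd j}" for j
      proof -
        have "j mod 3 = 0" using that by (simp add: dvd_eq_mod_eq_0)
        then show ?thesis by (simp add: h_def chi3_def)
      qed
      show "h j = 0" if "j \<in> {j. \<not> 3 dvd j} - {1..}" for j
      proof -
        have "j = 0" using that by (simp add: not_le)
        then show ?thesis using that by simp
      qed
    qed simp
    also have "\<dots> = (\<Sum>\<^sub>\<infinity>n. h (nat \<bar>3 * n + 1\<bar>))"
      by (rule infsum_reindex_bij_betw[OF bij_abs_arith_progression, symmetric])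
    also have "\<dots> = (\<Sum>\<^sub>\<infinity>n. q * (q powi (3 * n) * (2 * pole q n ^ 3 - pole q n ^ 2)))"
    proof (rule infsum_cong)
      fix n :: int
      define t where "t = q powi (3 * n + 1)"
      have t: "t \<noteq> 0" "1 - t \<noteq> 0" using q pole_denom_nonzero[OF q, of n] by (simp_all add: t_def)
      have "q * q powi (3 * n) = t" using q by (simp add: t_def power_int_add)
      then have "q * (q powi (3 * n) * (2 * pole q n ^ 3 - pole q n ^ 2)) = t * (2 * (1 / (1 - t)) ^ 3 - (1 / (1 - t)) ^ 2)"
        by (simp add: pole_def t_def[symmetric] flip: mult.assoc)
      also have "\<dots> = L t"
        unfolding L_def using t by (simp add: divide_simps power2_eq_square power3_eq_cube) algebra
      also have "\<dots> = h (nat \<bar>3 * n + 1\<bar>)"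
      proof (cases "0 \<le> n")
        case True
        then obtain m where m: "n = int m" using nonneg_int_cases by blast
        have j: "nat \<bar>3 * n + 1\<bar> = 3 * m + 1" using m by simp
        have "3 * n + 1 = int (3 * m + 1)" using m by simp
        then have "t = q ^ (3 * m + 1)" unfolding t_def by (simp only: power_int_of_nat)
        moreover have "(3 * m + 1) mod 3 = 1" by presburger
        ultimately show ?thesis unfolding h_def j by (simp add: chi3_def)
      next
        case False
        define m where "m = nat (- n - 1)"
        have n: "n = - int m - 1" using False by (simp add: m_def)
        have j: "nat \<bar>3 * n + 1\<bar> = 3 * m + 2" using n by simp
        define s where "s = q ^ (3 * m + 2)"
        have "3 * n + 1 = - int (3 * m + 2)" using n by simp
        then have ts: "t = inverse s" unfolding t_def s_def by (simp only: power_int_minus power_int_of_nat)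
        have s: "s \<noteq> 0" "1 - s \<noteq> 0" using unit[of "3 * m + 2"] by (auto simp: s_def)
        have "s - 1 \<noteq> 0" using s by simp
        then have "L t = - L s"
          unfolding L_def ts using s by (simp add: divide_simps power3_eq_cube) (simp add: algebra_simps)
        moreover have "(3 * m + 2) mod 3 = 2" by presburger
        ultimately show ?thesis unfolding h_def j s_def by (simp add: chi3_def)
      qed
      finally show "h (nat \<bar>3 * n + 1\<bar>) = q * (q powi (3 * n) * (2 * pole q n ^ 3 - pole q n ^ 2))" ..
    qed
    also have "\<dots> = q * pole_sum q 1 1 ^ 3"
      unfolding infsum_cmult_right' pole_sum_1_1_cubed[OF q] ..
    finally show ?thesis .
  qed
  have fib: "{x \<in> ?P. (\<lambda>(j, k). j * k) x = n} = {(j, k). 1 \<le> j \<and> 1 \<le> k \<and> j * k = n}" for n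
    by auto
  have fin: "finite {(j, k). 1 \<le> j \<and> 1 \<le> k \<and> j * k = (n::nat)}" for n
  proof (rule finite_subset)
    show "{(j, k). 1 \<le> j \<and> 1 \<le> k \<and> j * k = n} \<subseteq> {..n} \<times> {..n}" by auto
  qed simp
  have "((\<lambda>n. \<Sum>x\<in>{(j, k). 1 \<le> j \<and> 1 \<le> k \<and> j * k = n}. f x) has_sum q * pole_sum q 1 1 ^ 3) UNIV"
    using has_sum_group_by[OF F, of "\<lambda>(j, k). j * k"] fin unfolding fib total by simp
  moreover have "(\<Sum>x\<in>{(j, k). 1 \<le> j \<and> 1 \<le> k \<and> j * k = n}. f x) = real_of_int (twisted_divisor_sum n) * q ^ n" for n
    unfolding twisted_divisor_sum_def of_int_sum sum_distrib_right by (rule sum.cong) (auto simp: f_def)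
  ultimately show ?thesis by simp
qed

text \<open>
The zeros of a nonzero power series cannot accumulate at 0.
\<close>

lemma power_series_coeffs_zero:
  fixes c :: "nat \<Rightarrow> real"
  assumes "\<And>q. 0 < q \<Longrightarrow> q < 1 \<Longrightarrow> (\<lambda>n. c n * q ^ n) sums 0" and "c 0 = 0"
  shows "c n = 0"
proof (rule ccontr)
  assume "c n \<noteq> 0"
  define f where "f = (\<lambda>x. \<Sum>n. c n * x ^ n)"
  have sm: "(\<lambda>n. c n * (x - 0) ^ n) sums f x" if "norm (x - 0) < 1" for x
  proof -
    have "summable (\<lambda>n. c n * ((\<bar>x\<bar> + 1) / 2) ^ n)"
      using assms(1)[of "(\<bar>x\<bar> + 1) / 2"] that by (auto simp: sums_iff)
    then have "summable (\<lambda>n. c n * x ^ n)"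
      by (rule powser_inside) (use that in auto)
    then show ?thesis by (simp add: f_def summable_sums)
  qed
  have "f 0 = 0" using assms(2) by (simp add: f_def)
  moreover have "n > 0" using \<open>c n \<noteq> 0\<close> assms(2) by (cases n) auto
  ultimately obtain s where s: "0 < s" "\<And>z. z \<in> cball 0 s - {0} \<Longrightarrow> f z \<noteq> 0"
    using powser_0_nonzero[of 1 0 c f n] sm \<open>c n \<noteq> 0\<close> by auto
  define z where "z = min s (1 / 2)"
  have "0 < z" "z < 1" "z \<in> cball 0 s - {0}" using s(1) by (auto simp: z_def)
  moreover have "f z = 0" using assms(1)[of z] calculation by (simp add: f_def sums_iff)
  ultimately show False using s(2) by blast
qed

text \<open>
Both sides, as coefficients at \<open>q\<^bsup>n+1\<^esup>\<close>, belong to power series that agree for \<open>0 < q < 1\<close>.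
\<close>

theorem B3_eq_twisted_divisor_sum: "int (B3 n) = twisted_divisor_sum (Suc n)"
proof -
  define c where "c = (\<lambda>n. real_of_int (twisted_divisor_sum n) - (case n of 0 \<Rightarrow> 0 | Suc m \<Rightarrow> real (B3 m)))"
  have "c (Suc n) = 0"
  proof (rule power_series_coeffs_zero)
    have empty: "{(j, k). 1 \<le> j \<and> 1 \<le> k \<and> j * k = (0::nat)} = {}" by auto
    show "c 0 = 0" unfolding c_def twisted_divisor_sum_def empty by simp
  next
    fix q :: real assume q: "0 < q" "q < 1"
    define T where "T = infsum (\<lambda>ab. q powi core3_energy ab) UNIV"
    have "T = pole_sum q 1 1"
      unfolding T_def core3_sum_eq_lambert[OF q] pole_sum_def pole_def by simp
    then have "(\<lambda>n. real_of_int (twisted_divisor_sum n) * q ^ n) sums (q * T ^ 3)"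
      using has_sum_imp_sums[OF eisenstein_expansion[OF q]] by simp
    moreover have "(\<lambda>n. (case n of 0 \<Rightarrow> 0 | Suc m \<Rightarrow> real (B3 m)) * q ^ n) sums (q * T ^ 3)"
    proof -
      have "(\<lambda>n. q * (real (B3 n) * q ^ n)) sums (q * T ^ 3)"
        using has_sum_imp_sums[OF core_triples_generating_function[OF q]]
        unfolding T_def by (rule sums_mult)
      then show ?thesis
        using sums_Suc_iff[of "\<lambda>n. (case n of 0 \<Rightarrow> 0 | Suc m \<Rightarrow> real (B3 m)) * q ^ n" "q * T ^ 3"]
        by (simp add: mult_ac)
    qed
    ultimately show "(\<lambda>n. c n * q ^ n) sums 0"
      using sums_diff[of _ "q * T ^ 3" _ "q * T ^ 3"] by (fastforce simp: c_def left_diff_distrib)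
  qed
  then have "real_of_int (twisted_divisor_sum (Suc n)) = real_of_int (int (B3 n))" by (simp add: c_def)
  then show ?thesis by (simp only: of_int_eq_iff)
qed

section \<open>Divisibility by 120\<close>

text \<open>
Modulo 8 and modulo 3 all units have square 1.  Modulo 5, \<open>j\<^sup>2 k\<^sup>2 = 1\<close> and squares of units are 1 or -1,
hence \<open>j\<^sup>2 = k\<^sup>2\<close>.
\<close>

lemma dvd_120_square_diff:
  fixes j k :: nat
  assumes "odd (j * k)" "j * k mod 3 \<noteq> 0" "j * k mod 5 = 1 \<or> j * k mod 5 = 4"
  shows "120 dvd int k ^ 2 - int j ^ 2"
proof -
  have 8: "int x ^ 2 mod 8 = 1" if x: "odd x" for x :: nat
  proof -
    obtain m where m: "x = 2 * m + 1" using x by (rule oddE)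
    obtain i where "m * (m + 1) = 2 * i" using evenE[of "m * (m + 1)"] by auto
    then have "x ^ 2 = 1 + 8 * i" unfolding m by (simp add: power2_eq_square algebra_simps)
    then have "int x ^ 2 = 1 + 8 * int i" by (metis of_nat_1 of_nat_add of_nat_mult of_nat_numeral of_nat_power)
    then show ?thesis by simp
  qed
  have 3: "int x ^ 2 mod 3 = 1" if "x mod 3 \<noteq> 0" for x :: nat
  proof -
    have "x mod 3 = 1 \<or> x mod 3 = 2" using that by linarith
    moreover have "x ^ 2 mod 3 = (x mod 3) ^ 2 mod 3" by (simp only: power_mod)
    ultimately have "x ^ 2 mod 3 = 1" by (elim disjE) (simp_all only:, simp_all)
    then have "int (x ^ 2 mod 3) = int 1" by (rule arg_cong)
    then show ?thesis by (simp only: zmod_int of_nat_power of_nat_numeral of_nat_1)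
  qed
  have "8 dvd int k ^ 2 - int j ^ 2"
    using 8[of j] 8[of k] assms(1) by (simp flip: mod_eq_dvd_iff)
  moreover have "3 dvd int k ^ 2 - int j ^ 2"
  proof -
    have "j mod 3 \<noteq> 0" "k mod 3 \<noteq> 0"
      using assms(2) by (metis dvd_eq_mod_eq_0 dvd_mult2, metis dvd_eq_mod_eq_0 dvd_mult)
    then show ?thesis using 3[of j] 3[of k] by (simp flip: mod_eq_dvd_iff)
  qed
  moreover have "5 dvd int k ^ 2 - int j ^ 2"
  proof -
    have "j mod 5 < 5" "k mod 5 < 5" by simp_all
    then have "j mod 5 \<in> {0, 1, 2, 3, 4}" "k mod 5 \<in> {0, 1, 2, 3, 4}"
      by (simp_all only: insert_iff empty_iff) linarith+
    moreover have "(j mod 5) * (k mod 5) mod 5 = 1 \<or> (j mod 5) * (k mod 5) mod 5 = 4"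
      using assms(3) by (simp only: mod_mult_eq)
    ultimately have "(k mod 5) ^ 2 mod 5 = (j mod 5) ^ 2 mod 5"
      by (elim insertE emptyE) (simp_all only:, simp_all)
    then have "k ^ 2 mod 5 = j ^ 2 mod 5" by (simp only: power_mod)
    then have "int (k ^ 2 mod 5) = int (j ^ 2 mod 5)" by (rule arg_cong)
    then have "int k ^ 2 mod 5 = int j ^ 2 mod 5" by (simp only: zmod_int of_nat_power of_nat_numeral)
    then show ?thesis by (simp only: mod_eq_dvd_iff)
  qed
  moreover have "coprime (8 :: int) 3" "coprime (8 * 3 :: int) 5"
    by (simp_all add: coprime_iff_gcd_eq_1 gcd_non_0_int)
  ultimately have "8 * 3 * 5 dvd int k ^ 2 - int j ^ 2" by (intro divides_mult)
  then show ?thesis by simp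
qed

text \<open>
As \<open>n\<close> is 2 modulo 3, swapping the factors exchanges the pairs with \<open>chi3 j = 1\<close> and those with
\<open>chi3 j = -1\<close>.
\<close>

lemma dvd_120_twisted_divisor_sum:
  assumes "odd n" "n mod 3 = 2" "n mod 5 = 1 \<or> n mod 5 = 4"
  shows "120 dvd twisted_divisor_sum n"
proof -
  let ?P = "{(j, k). 1 \<le> j \<and> 1 \<le> k \<and> j * k = n}"
  let ?P1 = "{(j, k). 1 \<le> j \<and> 1 \<le> k \<and> j * k = n \<and> j mod 3 = 1}"
  let ?P2 = "{(j, k). 1 \<le> j \<and> 1 \<le> k \<and> j * k = n \<and> j mod 3 = 2}"
  have "?P \<subseteq> {..n} \<times> {..n}" by auto
  then have fin: "finite ?P" by (rule finite_subset) simp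
  have res: "j mod 3 = 1 \<and> k mod 3 = 2 \<or> j mod 3 = 2 \<and> k mod 3 = 1" if "j * k = n" for j k
  proof -
    have "(j mod 3) * (k mod 3) mod 3 = 2" using that assms(2) by (simp add: mod_mult_eq)
    moreover have "j mod 3 = 0 \<or> j mod 3 = 1 \<or> j mod 3 = 2" "k mod 3 = 0 \<or> k mod 3 = 1 \<or> k mod 3 = 2"
      by linarith+
    ultimately show ?thesis by (elim disjE) (simp_all only:, simp_all)
  qed
  have P: "?P = ?P1 \<union> ?P2" using res by blast
  have "finite ?P1" "finite ?P2" using fin by (auto intro: finite_subset[OF _ fin])
  moreover have "?P1 \<inter> ?P2 = {}" by auto
  ultimately have "twisted_divisor_sum n = (\<Sum>(j, k)\<in>?P1. chi3 j * int k ^ 2) + (\<Sum>(j, k)\<in>?P2. chi3 j * int k ^ 2)"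
    unfolding twisted_divisor_sum_def P by (rule sum.union_disjoint)
  also have "(\<Sum>(j, k)\<in>?P1. chi3 j * int k ^ 2) = (\<Sum>(j, k)\<in>?P1. int k ^ 2)"
    by (rule sum.cong) (auto simp: chi3_def)
  also have "(\<Sum>(j, k)\<in>?P2. chi3 j * int k ^ 2) = (\<Sum>(j, k)\<in>?P1. - (int j ^ 2))"
  proof (rule sum.reindex_bij_witness[of _ prod.swap prod.swap])
    fix x assume "x \<in> ?P2"
    then show "prod.swap x \<in> ?P1" using res[of "fst x" "snd x"] by (cases x) (auto simp: mult.commute)
  next
    fix x assume "x \<in> ?P1"
    then show "prod.swap x \<in> ?P2" using res[of "fst x" "snd x"] by (cases x) (auto simp: mult.commute)
  qed (auto simp: chi3_def)
  also have "(\<Sum>(j, k)\<in>?P1. int k ^ 2) + (\<Sum>(j, k)\<in>?P1. - (int j ^ 2)) = (\<Sum>(j, k)\<in>?P1. int k ^ 2 - int j ^ 2)"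
    unfolding sum.distrib[symmetric] by (rule sum.cong) auto
  finally have "twisted_divisor_sum n = (\<Sum>(j, k)\<in>?P1. int k ^ 2 - int j ^ 2)" .
  moreover have "120 dvd (case x of (j, k) \<Rightarrow> int k ^ 2 - int j ^ 2)" if "x \<in> ?P1" for x
  proof -
    obtain j k where x: "x = (j, k)" by (cases x)
    then have "j * k = n" using that by simp
    then show ?thesis using dvd_120_square_diff[of j k] assms x by simp
  qed
  ultimately show ?thesis by (simp only: dvd_sum)
qed

theorem theorem2p5:
  fixes n :: nat
  shows "[B3 (30 * n + 10) = 0] (mod 120) \<and> [B3 (30 * n + 28) = 0] (mod 120)"
proof -
  have *: "120 dvd B3 m"
    if "odd (Suc m)" "Suc m mod 3 = 2" "Suc m mod 5 = 1 \<or> Suc m mod 5 = 4" for m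
  proof -
    have "int 120 dvd int (B3 m)"
      using dvd_120_twisted_divisor_sum[OF that] unfolding B3_eq_twisted_divisor_sum by simp
    then show ?thesis by (simp only: int_dvd_int_iff)
  qed
  have "120 dvd B3 (30 * n + 10)"
  proof (rule *)
    have e: "Suc (30 * n + 10) = 2 + 3 * (10 * n + 3)" "Suc (30 * n + 10) = 1 + 5 * (6 * n + 2)" by simp_all
    show "odd (Suc (30 * n + 10))" by simp
    show "Suc (30 * n + 10) mod 3 = 2" unfolding e(1) by (simp only: mod_mult_self2) simp
    show "Suc (30 * n + 10) mod 5 = 1 \<or> Suc (30 * n + 10) mod 5 = 4"
      unfolding e(2) by (simp only: mod_mult_self2) simp
  qed
  moreover have "120 dvd B3 (30 * n + 28)"
  proof (rule *)
    have e: "Suc (30 * n + 28) = 2 + 3 * (10 * n + 9)" "Suc (30 * n + 28) = 4 + 5 * (6 * n + 5)" by simp_all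
    show "odd (Suc (30 * n + 28))" by simp
    show "Suc (30 * n + 28) mod 3 = 2" unfolding e(1) by (simp only: mod_mult_self2) simp
    show "Suc (30 * n + 28) mod 5 = 1 \<or> Suc (30 * n + 28) mod 5 = 4"
      unfolding e(2) by (simp only: mod_mult_self2) simp
  qed
  ultimately show ?thesis by (simp add: cong_0_iff)
qed

end
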